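(* Let $\mathcal{F}$ be a family of finite tournaments, each of size at least $3$. Then the isomorphism relation on countable $\mathcal{F}$-free digraphs is Borel reducible to the conjugacy relation on $\mathrm{Aut}(\Gamma_{\mathcal{F}})$. Hence the conjugacy relation on $\mathrm{Aut}(\Gamma_{\mathcal{F}})$ is Borel complete.
   Context: A digraph is a set with an irreflexive antisymmetric binary relation $\to$; a tournament is a digraph in which any two distinct vertices are joined by an edge. A digraph is $\mathcal{F}$-free if it contains no induced copy of any member of $\mathcal{F}$. $\Gamma_{\mathcal{F}}$ is the generic countable $\mathcal{F}$-free digraph: the unique countable homogeneous digraph whose finite induced subdigraphs are exactly the finite $\mathcal{F}$-free digraphs. The isomorphism relation is on the standard Borel space of $\mathcal{F}$-free digraphs on $\mathbb{N}$; conjugacy on $\mathrm{Aut}(\Gamma_{\mathcal{F}})$ identifies $\phi,\psi$ iff $\psi=\delta\phi\delta^{-1}$ for some automorphism $\delta$. $E\leq_B F$ means there is a Borel $f$ with $x\mathrel{E}x'\iff f(x)\mathrel{F}f(x')$; $E$ is Borel complete if isomorphism on every Borel class of countable structures in a countable relational language Borel reduces to $E$. *)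

theory Defs
  imports "HOL-Analysis.Analysis" "HOL-Algebra.Bij"
begin

record 'a oriented =
  vertices :: "'a set"
  edges :: "'a rel"

definition is_digraph :: "'a oriented \<Rightarrow> bool" where
  "is_digraph D \<longleftrightarrow>
     edges D \<subseteq> vertices D \<times> vertices D \<and> irrefl (edges D) \<and> antisym (edges D)"

definition is_tournament :: "'a oriented \<Rightarrow> bool" where
  "is_tournament D \<longleftrightarrow> is_digraph D \<and> total_on (vertices D) (edges D)"

definition induced :: "'a oriented \<Rightarrow> 'a set \<Rightarrow> 'a oriented" where
  "induced D A = \<lparr>vertices = A, edges = edges D \<inter> A \<times> A\<rparr>"

definition digraph_iso :: "('a \<Rightarrow> 'b) \<Rightarrow> 'a oriented \<Rightarrow> 'b oriented \<Rightarrow> bool" where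
  "digraph_iso f D D' \<longleftrightarrow> bij_betw f (vertices D) (vertices D') \<and>
     (\<forall>x\<in>vertices D. \<forall>y\<in>vertices D. (x, y) \<in> edges D \<longleftrightarrow> (f x, f y) \<in> edges D')"

definition digraph_isomorphic :: "'a oriented \<Rightarrow> 'b oriented \<Rightarrow> bool" where
  "digraph_isomorphic D D' \<longleftrightarrow> (\<exists>f. digraph_iso f D D')"

definition has_induced_copy :: "'a oriented \<Rightarrow> 'b oriented \<Rightarrow> bool" where
  "has_induced_copy D H \<longleftrightarrow> (\<exists>A\<subseteq>vertices D. digraph_isomorphic H (induced D A))"

definition free_of :: "'t oriented set \<Rightarrow> 'a oriented \<Rightarrow> bool" where
  "free_of \<F> D \<longleftrightarrow> (\<forall>T\<in>\<F>. \<not> has_induced_copy D T)"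

text \<open>As in \<^theory>\<open>HOL-Algebra.Bij\<close>, a permutation of the vertex set is represented by a
  function that is \<^const>\<open>undefined\<close> outside it, so that equality of automorphisms is
  equality of functions.\<close>

definition Aut :: "'a oriented \<Rightarrow> ('a \<Rightarrow> 'a) set" where
  "Aut D = {\<phi> \<in> extensional (vertices D). digraph_iso \<phi> D D}"

definition aut_group :: "'a oriented \<Rightarrow> ('a \<Rightarrow> 'a) monoid" where
  "aut_group D = (BijGroup (vertices D))\<lparr>carrier := Aut D\<rparr>"

definition conjugate :: "('g, 'm) monoid_scheme \<Rightarrow> 'g \<Rightarrow> 'g \<Rightarrow> bool" where
  "conjugate G \<phi> \<psi> \<longleftrightarrow>
     (\<exists>\<delta>\<in>carrier G. \<psi> = \<delta> \<otimes>\<^bsub>G\<^esub> \<phi> \<otimes>\<^bsub>G\<^esub> inv\<^bsub>G\<^esub> \<delta>)"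

definition homogeneous :: "'a oriented \<Rightarrow> bool" where
  "homogeneous D \<longleftrightarrow>
     (\<forall>A B f. A \<subseteq> vertices D \<and> B \<subseteq> vertices D \<and> finite A \<and> finite B \<and>
        digraph_iso f (induced D A) (induced D B) \<longrightarrow>
        (\<exists>\<phi>\<in>Aut D. \<forall>x\<in>A. \<phi> x = f x))"

text \<open>The finite induced subdigraphs are specified up to isomorphism, so it is enough to let
  \<open>H\<close> range over finite digraphs with vertices in \<open>nat\<close>. By Fraisse's theorem the digraph
  described here is unique up to isomorphism.\<close>

definition is_generic :: "'t oriented set \<Rightarrow> 'a oriented \<Rightarrow> bool" where
  "is_generic \<F> \<Gamma> \<longleftrightarrow>
     is_digraph \<Gamma> \<and> countable (vertices \<Gamma>) \<and> homogeneous \<Gamma> \<and>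
     (\<forall>H :: nat oriented. is_digraph H \<and> finite (vertices H) \<longrightarrow>
        (has_induced_copy \<Gamma> H \<longleftrightarrow> free_of \<F> H))"

text \<open>All the spaces below are subspaces of countable products of countable discrete spaces.
  For such products the product sigma-algebra is the Borel sigma-algebra of the product
  topology.\<close>

text \<open>A digraph on \<open>nat\<close> is a point of the space \<open>2^(nat \<times> nat)\<close>, via the characteristic
  function of its edge relation.\<close>

definition digraph_on_nat :: "(nat \<times> nat \<Rightarrow> bool) \<Rightarrow> nat oriented" where
  "digraph_on_nat R = \<lparr>vertices = UNIV, edges = Collect R\<rparr>"

definition free_digraph_space :: "'t oriented set \<Rightarrow> (nat \<times> nat \<Rightarrow> bool) measure" where
  "free_digraph_space \<F> =
     restrict_space (Pi\<^sub>M UNIV (\<lambda>_. count_space UNIV))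
       {R. is_digraph (digraph_on_nat R) \<and> free_of \<F> (digraph_on_nat R)}"

definition isomorphic_on_nat :: "(nat \<times> nat \<Rightarrow> bool) \<Rightarrow> (nat \<times> nat \<Rightarrow> bool) \<Rightarrow> bool" where
  "isomorphic_on_nat R S \<longleftrightarrow> digraph_isomorphic (digraph_on_nat R) (digraph_on_nat S)"

text \<open>For a countable digraph, this carries the Borel sets of the topology of pointwise
  convergence.\<close>

definition aut_space :: "'a oriented \<Rightarrow> ('a \<Rightarrow> 'a) measure" where
  "aut_space D =
     restrict_space (Pi\<^sub>M (vertices D) (\<lambda>_. count_space (vertices D))) (Aut D)"

definition borel_reducible ::
    "'x measure \<Rightarrow> ('x \<Rightarrow> 'x \<Rightarrow> bool) \<Rightarrow> 'y measure \<Rightarrow> ('y \<Rightarrow> 'y \<Rightarrow> bool) \<Rightarrow> bool" where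
  "borel_reducible X E Y F \<longleftrightarrow>
     (\<exists>f \<in> measurable X Y. \<forall>x\<in>space X. \<forall>x'\<in>space X. E x x' \<longleftrightarrow> F (f x) (f x'))"

text \<open>A countable relational language is a set \<open>I\<close> of relation symbols, without loss of
  generality natural numbers, and an arity function \<open>ar\<close>. A structure with universe \<open>nat\<close> is
  a point of the product over \<open>i \<in> I\<close> of the spaces \<open>2^(nat^(ar i))\<close>, written as a
  truth-value assignment to the pairs consisting of a symbol and a tuple of its arity.\<close>

definition atoms :: "nat set \<Rightarrow> (nat \<Rightarrow> nat) \<Rightarrow> (nat \<times> nat list) set" where
  "atoms I ar = (SIGMA i:I. {xs. length xs = ar i})"

definition structure_space ::
    "nat set \<Rightarrow> (nat \<Rightarrow> nat) \<Rightarrow> (nat \<times> nat list \<Rightarrow> bool) measure" where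
  "structure_space I ar = Pi\<^sub>M (atoms I ar) (\<lambda>_. count_space UNIV)"

definition structure_isomorphic ::
    "nat set \<Rightarrow> (nat \<Rightarrow> nat) \<Rightarrow> (nat \<times> nat list \<Rightarrow> bool) \<Rightarrow> (nat \<times> nat list \<Rightarrow> bool) \<Rightarrow> bool"
  where
  "structure_isomorphic I ar M N \<longleftrightarrow>
     (\<exists>f. bij f \<and> (\<forall>(i, xs)\<in>atoms I ar. M (i, xs) \<longleftrightarrow> N (i, map f xs)))"

definition borel_class ::
    "nat set \<Rightarrow> (nat \<Rightarrow> nat) \<Rightarrow> (nat \<times> nat list \<Rightarrow> bool) set \<Rightarrow> bool" where
  "borel_class I ar K \<longleftrightarrow> K \<in> sets (structure_space I ar) \<and>
     (\<forall>M\<in>K. \<forall>N\<in>space (structure_space I ar). structure_isomorphic I ar M N \<longrightarrow> N \<in> K)"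

definition borel_complete :: "'y measure \<Rightarrow> ('y \<Rightarrow> 'y \<Rightarrow> bool) \<Rightarrow> bool" where
  "borel_complete Y F \<longleftrightarrow>
     (\<forall>I ar K. borel_class I ar K \<longrightarrow>
        borel_reducible (restrict_space (structure_space I ar) K) (structure_isomorphic I ar) Y F)"

end

theory Submission
  imports Defs
begin

text \<open>A member of \<open>\<F>\<close> is a tournament, so adding non-adjacent new vertices to an \<open>\<F>\<close>-free
  digraph keeps it \<open>\<F>\<close>-free as soon as each new vertex does so separately. Starting from an
  \<open>\<F>\<close>-free digraph, one adds infinitely many vertices, indexed by the integers, for every
  admissible finite pattern of in- and out-neighbours, and iterates. The result is generic, and
  shifting all indices by one is an automorphism whose fixed points form exactly the original
  digraph, so isomorphic digraphs correspond to conjugate automorphisms. A back-and-forth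
  construction carries the automorphism over to the given generic digraph; each of its values
  depends on only finitely many edges of the original digraph, which makes the reduction Borel.

  A tournament with at least three vertices does not embed into a bipartite digraph, so coding
  structures into bipartite digraphs gives Borel completeness.\<close>

text \<open>Uniqueness of the generic digraph does not help as a black box: it yields some
  isomorphism for each \<open>R\<close>, but no Borel choice of one. Hence every step has to depend
  on finitely many edges. The extension lives on a fixed set of terms, an edge between two terms
  consults \<open>R\<close> only on base vertices occurring in them, and the back-and-forth takes
  the first suitable candidate of a fixed enumeration. The integer index has two tasks. It lets the
  shift be a bijection moving every new vertex, even where the pattern consists of base vertices and
  stays the same; and infinitely many vertices per pattern always leave one not yet tied to a given
  finite set, as one-point extensions require. The coding of structures obeys the same demand: all
  structures share one vertex set, and each edge consults at most one atom.\<close>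

definition emb :: "('a \<Rightarrow> 'b) \<Rightarrow> 'a oriented \<Rightarrow> 'b oriented \<Rightarrow> bool" where
  "emb f H D \<longleftrightarrow> inj_on f (vertices H) \<and> f ` vertices H \<subseteq> vertices D \<and>
     (\<forall>x\<in>vertices H. \<forall>y\<in>vertices H. (x, y) \<in> edges H \<longleftrightarrow> (f x, f y) \<in> edges D)"

lemma emb_cong: "(\<And>x. x \<in> vertices H \<Longrightarrow> f x = g x) \<Longrightarrow> emb f H D \<longleftrightarrow> emb g H D"
  unfolding emb_def by (simp cong: inj_on_cong image_cong)

lemma vertices_induced [simp]: "vertices (induced D A) = A"
  and edges_induced [simp]: "edges (induced D A) = edges D \<inter> A \<times> A"
  by (simp_all add: induced_def)

lemma emb_comp: "emb f A B \<Longrightarrow> emb g B C \<Longrightarrow> emb (g \<circ> f) A C"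
  unfolding emb_def by (auto intro!: comp_inj_on inj_on_subset[of g "vertices B"]) blast+

lemma emb_inv_into:
  assumes "emb f H D" "f ` vertices H = vertices D"
  shows "emb (inv_into (vertices H) f) D H"
  using assms unfolding emb_def
  by (auto simp: inj_on_inv_into inv_into_into f_inv_into_f)

lemma has_induced_copy_iff_emb: "has_induced_copy D H \<longleftrightarrow> (\<exists>f. emb f H D)"
proof
  assume "has_induced_copy D H"
  then show "\<exists>f. emb f H D"
    unfolding has_induced_copy_def digraph_isomorphic_def digraph_iso_def emb_def bij_betw_def
    by fastforce
next
  assume "\<exists>f. emb f H D"
  then obtain f where f: "emb f H D" ..
  then have "digraph_iso f H (induced D (f ` vertices H))" "f ` vertices H \<subseteq> vertices D"
    unfolding digraph_iso_def emb_def by (auto simp: bij_betw_def)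
  then show "has_induced_copy D H"
    unfolding has_induced_copy_def digraph_isomorphic_def by blast
qed

lemma free_of_iff_emb: "free_of \<F> D \<longleftrightarrow> (\<forall>T\<in>\<F>. \<forall>f. \<not> emb f T D)"
  by (simp add: free_of_def has_induced_copy_iff_emb)

lemma free_of_emb: "free_of \<F> D \<Longrightarrow> emb f H D \<Longrightarrow> free_of \<F> H"
  unfolding free_of_iff_emb using emb_comp by blast

lemma free_of_cong_emb:
  assumes "emb f H D" "f ` vertices H = vertices D"
  shows "free_of \<F> H \<longleftrightarrow> free_of \<F> D"
  using assms emb_inv_into free_of_emb by metis

lemma is_digraph_emb:
  assumes "emb f H D" "is_digraph D" "edges H \<subseteq> vertices H \<times> vertices H"
  shows "is_digraph H"
  unfolding is_digraph_def
proof (intro conjI)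
  show "irrefl (edges H)"
    using assms unfolding emb_def is_digraph_def irrefl_def by blast
  show "antisym (edges H)"
  proof (rule antisymI)
    fix x y assume xy: "(x, y) \<in> edges H" "(y, x) \<in> edges H"
    then have v: "x \<in> vertices H" "y \<in> vertices H" using assms by auto
    then have "(f x, f y) \<in> edges D" "(f y, f x) \<in> edges D"
      using xy assms(1) unfolding emb_def by auto
    then have "f x = f y" using assms(2) unfolding is_digraph_def antisym_def by blast
    then show "x = y" using v assms(1) unfolding emb_def inj_on_def by blast
  qed
qed (fact assms(3))

text \<open>Genericity and saturation quantify over finite digraphs on \<open>nat\<close>. This
  moves a finite part of any digraph there, with embeddings in both directions: freeness is pulled
  back along one, maps are carried over along the other.\<close>

lemma finite_digraph_on_nat:
  fixes D :: "'a oriented"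
  assumes "is_digraph D" "U \<subseteq> vertices D" "finite U"
  obtains H :: "nat oriented" and c :: "'a \<Rightarrow> nat"
  where "is_digraph H" "finite (vertices H)" "inj_on c U" "vertices H = c ` U"
    "emb (inv_into U c) H D" "emb c (induced D U) H"
proof -
  obtain c :: "'a \<Rightarrow> nat" where c: "inj_on c U"
    using assms(3) finite_imp_inj_to_nat_seg by metis
  define H where "H = \<lparr>vertices = c ` U, edges = {(c x, c y) |x y. x \<in> U \<and> y \<in> U \<and> (x, y) \<in> edges D}\<rparr>"
  have 1: "emb c (induced D U) H"
    using c by (auto simp: emb_def H_def inj_on_def)
  have "emb (inv_into U c) H (induced D U)"
    using emb_inv_into[OF 1] by (simp add: H_def)
  then have 2: "emb (inv_into U c) H D"
    using assms(2) unfolding emb_def by auto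
  have "is_digraph H"
    using is_digraph_emb[OF 2 assms(1)] by (auto simp: H_def)
  then show thesis
    using that[of H c] 1 2 c assms(3) by (simp add: H_def)
qed

section \<open>One-point extensions and generic digraphs\<close>

definition saturated :: "'t oriented set \<Rightarrow> 'a oriented \<Rightarrow> bool" where
  "saturated \<F> D \<longleftrightarrow> (\<forall>(H :: nat oriented) v e. is_digraph H \<and> finite (vertices H) \<and> free_of \<F> H \<and>
     v \<in> vertices H \<and> emb e (induced H (vertices H - {v})) D \<longrightarrow> (\<exists>w. emb (e(v := w)) H D))"

text \<open>Genericity only speaks of finite subdigraphs. A forbidden tournament is finite, so a
  copy of it in \<Gamma> would itself be such a subdigraph, free and yet containing the
  tournament.\<close>

lemma generic_free:
  fixes \<Gamma> :: "'v oriented"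
  assumes "is_generic \<F> \<Gamma>" and fin: "\<And>T. T \<in> \<F> \<Longrightarrow> is_tournament T \<and> finite (vertices T)"
  shows "free_of \<F> \<Gamma>"
  unfolding free_of_iff_emb
proof (intro ballI allI notI)
  fix T f assume T: "T \<in> \<F>" and f: "emb f T \<Gamma>"
  have dT: "is_digraph T" using fin[OF T] by (simp add: is_tournament_def)
  from finite_digraph_on_nat[OF dT subset_refl] fin[OF T]
  obtain H :: "nat oriented" and c where H: "is_digraph H" "finite (vertices H)"
    "emb (inv_into (vertices T) c) H T" "emb c (induced T (vertices T)) H" by metis
  have "induced T (vertices T) = T" using dT by (simp add: induced_def is_digraph_def Int_absorb2)
  with H have c: "emb c T H" by simp
  have "has_induced_copy \<Gamma> H"
    unfolding has_induced_copy_iff_emb using emb_comp[OF H(3) f] by blast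
  then have "free_of \<F> H"
    using assms(1) H unfolding is_generic_def by blast
  then show False using T c unfolding free_of_iff_emb by blast
qed

text \<open>Place \<open>H\<close> anywhere in \<Gamma> by an embedding \<open>d\<close>, then let
  homogeneity move the copy of \<open>H\<close> without \<open>v\<close> onto the image of
  \<open>e\<close>; the copy of \<open>v\<close> is carried along to the wanted vertex.\<close>

lemma generic_saturated:
  fixes \<Gamma> :: "'v oriented"
  assumes "is_generic \<F> \<Gamma>"
  shows "saturated \<F> \<Gamma>"
  unfolding saturated_def
proof (intro allI impI, elim conjE)
  fix H :: "nat oriented" and v e
  assume H: "is_digraph H" "finite (vertices H)" "free_of \<F> H" "v \<in> vertices H"
    and e: "emb e (induced H (vertices H - {v})) \<Gamma>"
  obtain d where d: "emb d H \<Gamma>"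
    using H assms unfolding is_generic_def has_induced_copy_iff_emb by blast
  define W where "W = vertices H - {v}"
  define f where "f = e \<circ> inv_into W d"
  have dW: "inj_on d W" using d by (auto simp: emb_def W_def inj_on_def)
  have eW: "inj_on e W" "e ` W \<subseteq> vertices \<Gamma>" using e by (auto simp: emb_def W_def inj_on_def)
  have fd: "f (d x) = e x" if "x \<in> W" for x
    using that dW by (simp add: f_def)
  have "digraph_iso f (induced \<Gamma> (d ` W)) (induced \<Gamma> (e ` W))"
    unfolding digraph_iso_def
  proof (intro conjI)
    show "bij_betw f (vertices (induced \<Gamma> (d ` W))) (vertices (induced \<Gamma> (e ` W)))"
      using eW dW by (auto simp: bij_betw_def inj_on_def fd image_image)
    show "\<forall>x\<in>vertices (induced \<Gamma> (d ` W)). \<forall>y\<in>vertices (induced \<Gamma> (d ` W)).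
      (x, y) \<in> edges (induced \<Gamma> (d ` W)) \<longleftrightarrow> (f x, f y) \<in> edges (induced \<Gamma> (e ` W))"
      using d e by (auto simp: fd emb_def W_def)
  qed
  moreover have "d ` W \<subseteq> vertices \<Gamma>" "finite W" using d H(2) by (auto simp: emb_def W_def)
  ultimately obtain \<phi> where \<phi>: "\<phi> \<in> Aut \<Gamma>" "\<forall>x\<in>d ` W. \<phi> x = f x"
    using assms eW unfolding is_generic_def homogeneous_def by (metis finite_imageI)
  have "emb \<phi> \<Gamma> \<Gamma>" using \<phi>(1) by (auto simp: Aut_def digraph_iso_def emb_def bij_betw_def)
  note emb_comp[OF d this]
  moreover have eq: "(e(v := \<phi> (d v))) x = (\<phi> \<circ> d) x" if "x \<in> vertices H" for x
    using \<phi>(2) fd[of x] that by (auto simp: W_def)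
  have "emb (e(v := \<phi> (d v))) H \<Gamma> \<longleftrightarrow> emb (\<phi> \<circ> d) H \<Gamma>" by (rule emb_cong) (rule eq)
  ultimately have "emb (e(v := \<phi> (d v))) H \<Gamma>" by blast
  then show "\<exists>w. emb (e(v := w)) H \<Gamma>" ..
qed

subsection \<open>Back and forth\<close>

text \<open>A relation with a condition symmetric in its two sides: taking converses turns a back
  step into a forth step.\<close>

definition partial_iso :: "'a oriented \<Rightarrow> 'b oriented \<Rightarrow> ('a \<times> 'b) set \<Rightarrow> bool" where
  "partial_iso D D' p \<longleftrightarrow> p \<subseteq> vertices D \<times> vertices D' \<and>
     (\<forall>a b a' b'. (a, b) \<in> p \<longrightarrow> (a', b') \<in> p \<longrightarrow>
        (a = a' \<longleftrightarrow> b = b') \<and> ((a, a') \<in> edges D \<longleftrightarrow> (b, b') \<in> edges D'))"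

lemma partial_isoD:
  assumes "partial_iso D D' p" "(a, b) \<in> p" "(a', b') \<in> p"
  shows "a = a' \<longleftrightarrow> b = b'" "(a, a') \<in> edges D \<longleftrightarrow> (b, b') \<in> edges D'"
  using assms unfolding partial_iso_def by simp_all

lemma partial_iso_empty [simp]: "partial_iso D D' {}"
  by (simp add: partial_iso_def)

lemma partial_iso_converse: "partial_iso D D' p \<Longrightarrow> partial_iso D' D (p\<inverse>)"
  unfolding partial_iso_def by blast

text \<open>Read through a copy on \<open>nat\<close> of the domain enlarged by \<open>a\<close>,
  \<open>p\<close> is an embedding of that copy minus one point, and saturation of \<open>D'\<close>
  extends it. The copy inherits freeness from \<open>D\<close>.\<close>

lemma partial_iso_extend:
  fixes D :: "'a oriented" and D' :: "'b oriented"
  assumes D: "is_digraph D" "free_of \<F> D" and D': "saturated \<F> D'"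
    and p: "finite p" "partial_iso D D' p" and a: "a \<in> vertices D"
  shows "\<exists>b\<in>vertices D'. partial_iso D D' (insert (a, b) p)"
proof (cases "a \<in> fst ` p")
  case True
  then obtain b where "(a, b) \<in> p" by auto
  moreover from this have "b \<in> vertices D'" using p(2) unfolding partial_iso_def by blast
  ultimately show ?thesis using p(2) by (metis insert_absorb)
next
  case False
  define U where "U = insert a (fst ` p)"
  have U: "U \<subseteq> vertices D" "finite U" using p a by (auto simp: U_def partial_iso_def)
  from finite_digraph_on_nat[OF D(1) U]
  obtain H :: "nat oriented" and c where H: "is_digraph H" "finite (vertices H)" "inj_on c U"
    "vertices H = c ` U" "emb (inv_into U c) H D" "emb c (induced D U) H" by metis
  have cE: "(c x, c y) \<in> edges H \<longleftrightarrow> (x, y) \<in> edges D" if "x \<in> U" "y \<in> U" for x y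
    using H(6) that by (auto simp: emb_def)
  \<comment> \<open>Outside the copy of the domain of \<open>p\<close> this choice is arbitrary, and
    \<open>e\<close> is never consulted there.\<close>
  define e where "e n = (SOME b. (inv_into U c n, b) \<in> p)" for n
  have e: "e (c x) = b" if "(x, b) \<in> p" for x b
  proof -
    have "x \<in> U" using that by (force simp: U_def)
    then have "e (c x) = (SOME b. (x, b) \<in> p)" using H(3) by (simp add: e_def)
    also have "\<dots> = b" using that partial_isoD(1)[OF p(2)] by (blast intro: some_equality)
    finally show ?thesis .
  qed
  have V: "vertices H - {c a} = c ` fst ` p"
    using H(3,4) False by (auto simp: U_def inj_on_def)
  have "emb e (induced H (vertices H - {c a})) D'"
    unfolding V emb_def
  proof (intro conjI)
    show "inj_on e (vertices (induced H (c ` fst ` p)))"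
      using partial_isoD(1)[OF p(2)] by (force simp: inj_on_def e)
    show "e ` vertices (induced H (c ` fst ` p)) \<subseteq> vertices D'"
      using p(2) by (auto simp: e partial_iso_def)
    show "\<forall>x\<in>vertices (induced H (c ` fst ` p)). \<forall>y\<in>vertices (induced H (c ` fst ` p)).
      (x, y) \<in> edges (induced H (c ` fst ` p)) \<longleftrightarrow> (e x, e y) \<in> edges D'"
    proof -
      have "(c x, c y) \<in> edges H \<longleftrightarrow> (b, b') \<in> edges D'" if "(x, b) \<in> p" "(y, b') \<in> p" for x y b b'
        using partial_isoD(2)[OF p(2) that] cE[of x y] that by (force simp: U_def)
      then show ?thesis by (force simp: e)
    qed
  qed
  moreover have "free_of \<F> H" using free_of_emb[OF D(2) H(5)] .
  moreover have "c a \<in> vertices H" using H(4) by (simp add: U_def)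
  ultimately obtain w where w: "emb (e(c a := w)) H D'"
    using D' H(1,2) unfolding saturated_def by blast
  define k where "k = e(c a := w) \<circ> c"
  have "emb k (induced D U) D'" unfolding k_def by (rule emb_comp[OF H(6) w])
  moreover have "k x = b" if "(x, b) \<in> insert (a, w) p" for x b
  proof (cases "x = a")
    case True
    with that False show ?thesis by (force simp: k_def)
  next
    case F: False
    then have "x \<in> U" "(x, b) \<in> p" using that by (force simp: U_def)+
    then have "c x \<noteq> c a" using H(3) F by (auto simp: inj_on_def U_def)
    then show ?thesis using e \<open>(x, b) \<in> p\<close> by (simp add: k_def)
  qed
  ultimately have "partial_iso D D' (insert (a, w) p)" and "w \<in> vertices D'"
  proof -
    assume k: "emb k (induced D U) D'" and eq: "\<And>x b. (x, b) \<in> insert (a, w) p \<Longrightarrow> k x = b"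
    have mem: "x \<in> U" "b \<in> vertices D'" if "(x, b) \<in> insert (a, w) p" for x b
    proof -
      show "x \<in> U" using that by (force simp: U_def)
      then have "k x \<in> vertices D'" using k by (auto simp: emb_def)
      then show "b \<in> vertices D'" using eq[OF that] by simp
    qed
    show "w \<in> vertices D'" using mem by blast
    show "partial_iso D D' (insert (a, w) p)"
      unfolding partial_iso_def
    proof (intro conjI)
      show "insert (a, w) p \<subseteq> vertices D \<times> vertices D'"
      proof (rule subrelI)
        fix x b assume "(x, b) \<in> insert (a, w) p"
        from mem[OF this] U(1) show "(x, b) \<in> vertices D \<times> vertices D'" by blast
      qed
      have "(x = x' \<longleftrightarrow> b = b') \<and> ((x, x') \<in> edges D \<longleftrightarrow> (b, b') \<in> edges D')"
        if "(x, b) \<in> insert (a, w) p" "(x', b') \<in> insert (a, w) p" for x x' b b'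
        using k mem(1)[OF that(1)] mem(1)[OF that(2)] eq[OF that(1)] eq[OF that(2)]
        by (auto simp: emb_def inj_on_def)
      then show "\<forall>x b x' b'. (x, b) \<in> insert (a, w) p \<longrightarrow> (x', b') \<in> insert (a, w) p \<longrightarrow>
        (x = x' \<longleftrightarrow> b = b') \<and> ((x, x') \<in> edges D \<longleftrightarrow> (b, b') \<in> edges D')" by blast
    qed
  qed
  then show ?thesis by blast
qed

text \<open>The least index makes the choice of an image a matter of finitely many tests.\<close>

definition forth :: "(nat \<Rightarrow> 'b) \<Rightarrow> 'a oriented \<Rightarrow> 'b oriented \<Rightarrow> 'a \<Rightarrow> ('a \<times> 'b) set \<Rightarrow> ('a \<times> 'b) set" where
  "forth c D D' a p = insert (a, c (LEAST k. partial_iso D D' (insert (a, c k) p))) p"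

lemma forth:
  assumes "is_digraph D" "free_of \<F> D" "saturated \<F> D'" "range c = vertices D'"
    "finite p" "partial_iso D D' p" "a \<in> vertices D"
  shows "\<exists>k. partial_iso D D' (insert (a, c k) p)" "partial_iso D D' (forth c D D' a p)"
    "finite (forth c D D' a p)"
proof -
  obtain b where "b \<in> vertices D'" "partial_iso D D' (insert (a, b) p)"
    using partial_iso_extend[OF assms(1-3,5-7)] by blast
  moreover from this assms(4) obtain k where "b = c k" by blast
  ultimately show ex: "\<exists>k. partial_iso D D' (insert (a, c k) p)" by blast
  show "partial_iso D D' (forth c D D' a p)" unfolding forth_def using ex by (rule LeastI_ex)
  show "finite (forth c D D' a p)" using assms(5) by (simp add: forth_def)
qed

text \<open>No candidate beyond the least successful one influences the choice, so agreement on that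
  initial segment suffices.\<close>

lemma forth_cong:
  assumes "\<exists>k. partial_iso D D' (insert (a, c k) p)"
    and "\<And>k. k \<le> (LEAST k. partial_iso D D' (insert (a, c k) p)) \<Longrightarrow>
      partial_iso D2 D2' (insert (a, c k) p) \<longleftrightarrow> partial_iso D D' (insert (a, c k) p)"
  shows "forth c D2 D2' a p = forth c D D' a p"
proof -
  define K where "K = (LEAST k. partial_iso D D' (insert (a, c k) p))"
  have "partial_iso D D' (insert (a, c K) p)" unfolding K_def using assms(1) by (rule LeastI_ex)
  moreover have "\<not> partial_iso D D' (insert (a, c k) p)" if "k < K" for k
    using not_less_Least that unfolding K_def by blast
  ultimately have "(LEAST k. partial_iso D2 D2' (insert (a, c k) p)) = K"
    using assms(2)[folded K_def] by (intro Least_equality) (auto simp: not_less[symmetric])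
  then show ?thesis unfolding forth_def K_def by simp
qed

primrec back_forth ::
  "(nat \<Rightarrow> 'a) \<Rightarrow> (nat \<Rightarrow> 'b) \<Rightarrow> 'a oriented \<Rightarrow> 'b oriented \<Rightarrow> nat \<Rightarrow> ('a \<times> 'b) set" where
  "back_forth c c' D D' 0 = {}"
| "back_forth c c' D D' (Suc n) =
     (forth c D' D (c' n) ((forth c' D D' (c n) (back_forth c c' D D' n))\<inverse>))\<inverse>"

context
  fixes \<F> :: "'t oriented set" and D :: "'a oriented" and D' :: "'b oriented" and c :: "nat \<Rightarrow> 'a" and c' :: "nat \<Rightarrow> 'b"
  assumes D: "is_digraph D" "free_of \<F> D" "saturated \<F> D" "range c = vertices D"
    and D': "is_digraph D'" "free_of \<F> D'" "saturated \<F> D'" "range c' = vertices D'"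
begin

lemma c_mem: "c n \<in> vertices D" "c' n \<in> vertices D'"
  using D(4) D'(4) by blast+

lemma back_forth_partial_iso:
  "finite (back_forth c c' D D' n) \<and> partial_iso D D' (back_forth c c' D D' n)"
proof (induction n)
  case (Suc n)
  note 1 = forth[OF D(1,2) D'(3,4) Suc[THEN conjunct1] Suc[THEN conjunct2] c_mem(1)]
  have f: "finite ((forth c' D D' (c n) (back_forth c c' D D' n))\<inverse>)" using 1(3) by simp
  note 2 = forth[OF D'(1,2) D(3,4) f partial_iso_converse[OF 1(2)] c_mem(2)]
  from 2 show ?case by (simp add: partial_iso_converse)
qed simp

lemma back_forth_mono: "m \<le> n \<Longrightarrow> back_forth c c' D D' m \<subseteq> back_forth c c' D D' n"
  by (rule lift_Suc_mono_le) (auto simp: forth_def)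

lemma back_forth_total:
  "c n \<in> Domain (back_forth c c' D D' (Suc n))" "c' n \<in> Range (back_forth c c' D D' (Suc n))"
  by (auto simp: forth_def)

text \<open>Each stage performs finitely many tests on finite relations and so sees finitely many
  edges of \<open>D\<close>. The Borel measurability of the reduction to conjugacy rests on
  this.\<close>

lemma back_forth_local:
  "\<exists>U. finite U \<and> (\<forall>D2. vertices D2 = vertices D \<and>
     (\<forall>x\<in>U. \<forall>y\<in>U. (x, y) \<in> edges D2 \<longleftrightarrow> (x, y) \<in> edges D) \<longrightarrow>
     back_forth c c' D2 D' n = back_forth c c' D D' n)"
proof (induction n)
  case (Suc n)
  from Suc.IH obtain U where U: "finite U" "\<forall>D2. vertices D2 = vertices D \<and>
     (\<forall>x\<in>U. \<forall>y\<in>U. (x, y) \<in> edges D2 \<longleftrightarrow> (x, y) \<in> edges D) \<longrightarrow>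
     back_forth c c' D2 D' n = back_forth c c' D D' n" by (elim exE conjE) (rule that)
  define p where "p = back_forth c c' D D' n"
  define q where "q = (forth c' D D' (c n) p)\<inverse>"
  have p: "finite p" "partial_iso D D' p" using back_forth_partial_iso by (auto simp: p_def)
  note 1 = forth[OF D(1,2) D'(3,4) p c_mem(1)[of n]]
  have q: "finite q" "partial_iso D' D q" unfolding q_def using 1(3) partial_iso_converse[OF 1(2)] by simp_all
  note 2 = forth[OF D'(1,2) D(3,4) q c_mem(2)[of n]]
  define K where "K = (LEAST k. partial_iso D' D (insert (c' n, c k) q))"
  \<comment> \<open>The forth step tests candidates from \<open>D'\<close>, so in \<open>D\<close>
    it looks at \<open>c n\<close> and the domain of \<open>p\<close>; the back step tests
    candidates from \<open>D\<close> itself, those with index up to \<open>K\<close>.\<close>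
  define W where "W = U \<union> insert (c n) (fst ` p) \<union> snd ` q \<union> c ` {..K}"
  have "finite W" using U p q by (simp add: W_def)
  moreover have "back_forth c c' D2 D' (Suc n) = back_forth c c' D D' (Suc n)"
    if D2: "vertices D2 = vertices D"
      and eq: "\<forall>x\<in>W. \<forall>y\<in>W. (x, y) \<in> edges D2 \<longleftrightarrow> (x, y) \<in> edges D" for D2
  proof -
    have pc: "partial_iso D2 D' r \<longleftrightarrow> partial_iso D D' r" if "fst ` r \<subseteq> W" for r
    proof -
      have "(a, a') \<in> edges D2 \<longleftrightarrow> (a, a') \<in> edges D" if "(a, b) \<in> r" "(a', b') \<in> r" for a b a' b'
        using eq that \<open>fst ` r \<subseteq> W\<close> by force
      then show ?thesis unfolding partial_iso_def D2 by blast
    qed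
    have pc': "partial_iso D' D2 r \<longleftrightarrow> partial_iso D' D r" if "snd ` r \<subseteq> W" for r
      using pc[of "r\<inverse>"] that partial_iso_converse[of _ _ r] partial_iso_converse[of _ _ "r\<inverse>"]
      by (force simp: image_subset_iff)
    have "back_forth c c' D2 D' n = p"
      unfolding p_def using D2 eq by (intro U(2)[rule_format]) (simp add: W_def)
    moreover have "forth c' D2 D' (c n) p = forth c' D D' (c n) p"
      by (rule forth_cong[OF 1(1)], rule pc) (auto simp: W_def)
    moreover have "forth c D' D2 (c' n) q = forth c D' D (c' n) q"
      by (rule forth_cong[OF 2(1)], rule pc', unfold K_def[symmetric]) (auto simp: W_def)
    ultimately show ?thesis by (simp flip: p_def q_def)
  qed
  ultimately show ?case by blast
qed auto

definition limit_iso :: "('a \<times> 'b) set" where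
  "limit_iso = (\<Union>n. back_forth c c' D D' n)"

text \<open>The stages increase, so any two pairs of the limit lie together in one stage, and a
  partial isomorphism is tested on two pairs at a time.\<close>

lemma limit_iso:
  shows "partial_iso D D' limit_iso" "Domain limit_iso = vertices D" "Range limit_iso = vertices D'"
proof -
  have ex: "\<exists>n. x \<in> back_forth c c' D D' n \<and> y \<in> back_forth c c' D D' n"
    if "x \<in> limit_iso" "y \<in> limit_iso" for x y
  proof -
    obtain m n where "x \<in> back_forth c c' D D' m" "y \<in> back_forth c c' D D' n"
      using \<open>x \<in> limit_iso\<close> \<open>y \<in> limit_iso\<close> by (auto simp: limit_iso_def)
    then have "x \<in> back_forth c c' D D' (max m n)" "y \<in> back_forth c c' D D' (max m n)"
      using back_forth_mono[of _ "max m n"] by (meson max.cobounded1 max.cobounded2 subsetD)+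
    then show ?thesis by blast
  qed
  have sub: "limit_iso \<subseteq> vertices D \<times> vertices D'"
    using back_forth_partial_iso by (fastforce simp: limit_iso_def partial_iso_def)
  have "(a = a' \<longleftrightarrow> b = b') \<and> ((a, a') \<in> edges D \<longleftrightarrow> (b, b') \<in> edges D')"
    if ab: "(a, b) \<in> limit_iso" "(a', b') \<in> limit_iso" for a b a' b'
  proof -
    obtain n where n: "(a, b) \<in> back_forth c c' D D' n" "(a', b') \<in> back_forth c c' D D' n"
      using ex[OF ab] by blast
    from partial_isoD[OF conjunct2[OF back_forth_partial_iso] n] show ?thesis by simp
  qed
  with sub show "partial_iso D D' limit_iso" unfolding partial_iso_def by blast
  have step: "back_forth c c' D D' (Suc n) \<subseteq> limit_iso" for n
    unfolding limit_iso_def by (rule UN_upper) simp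
  have "c n \<in> Domain limit_iso" "c' n \<in> Range limit_iso" for n
    using back_forth_total[of n] Domain_mono[OF step] Range_mono[OF step] by blast+
  then have "vertices D \<subseteq> Domain limit_iso" "vertices D' \<subseteq> Range limit_iso"
    unfolding D(4)[symmetric] D'(4)[symmetric] by blast+
  with sub show "Domain limit_iso = vertices D" "Range limit_iso = vertices D'" by blast+
qed

end

subsection \<open>The free extension of a digraph\<close>

text \<open>\<open>New k A B\<close> is a new vertex with in-neighbours \<open>A\<close> and out-neighbours \<open>B\<close> among the earlier
  vertices. A term with an inadmissible pattern stays in the vertex set, but its edges are dropped:
  the vertex set and the shift of the indices then do not depend on the original digraph.\<close>

datatype (atoms_of: 'a) tm = Base 'a | New int "'a tm list" "'a tm list"

instance tm :: (countable) countable
  by countable_datatype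

text \<open>A link at a new vertex belongs to the end that lists the other, and exists only if that
  end lies in \<open>W\<close>. With \<open>W\<close> as a parameter, links can be used while the
  set of valid terms is still being defined.\<close>

definition links :: "('a \<times> 'a \<Rightarrow> bool) \<Rightarrow> 'a tm set \<Rightarrow> 'a tm rel" where
  "links R W = {(Base a, Base b) |a b. R (a, b)} \<union>
     {(s, New k A B) |s k A B. s \<in> set A \<and> New k A B \<in> W} \<union>
     {(New k A B, s) |s k A B. s \<in> set B \<and> New k A B \<in> W}"

lemma links_simps [simp]:
  "(Base a, Base b) \<in> links R W \<longleftrightarrow> R (a, b)"
  "(Base a, New k A B) \<in> links R W \<longleftrightarrow> Base a \<in> set A \<and> New k A B \<in> W"
  "(New k A B, Base a) \<in> links R W \<longleftrightarrow> Base a \<in> set B \<and> New k A B \<in> W"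
  "(New k A B, New k' A' B') \<in> links R W \<longleftrightarrow>
     New k A B \<in> set A' \<and> New k' A' B' \<in> W \<or> New k' A' B' \<in> set B \<and> New k A B \<in> W"
  by (auto simp: links_def)

lemma size_mem [simp]:
  "s \<in> set A \<Longrightarrow> size s < size (New k A B)" "s \<in> set B \<Longrightarrow> size s < size (New k A B)"
  using size_list_estimation'[of s A "size s" size] size_list_estimation'[of s B "size s" size]
  by auto

text \<open>The links of the term under test are switched on provisionally, those of a listed
  neighbour only if it is itself valid. The filtered lists show the termination proof that recursive
  calls go to list members, hence to smaller terms.\<close>

function valid :: "'t oriented set \<Rightarrow> ('a \<times> 'a \<Rightarrow> bool) \<Rightarrow> 'a tm \<Rightarrow> bool" where
  "valid \<F> R (Base a) \<longleftrightarrow> True"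
| "valid \<F> R (New k A B) \<longleftrightarrow> set A \<inter> set B = {} \<and>
     free_of \<F> (induced \<lparr>vertices = UNIV,
         edges = links R (insert (New k A B) (set (filter (valid \<F> R) A) \<union> set (filter (valid \<F> R) B)))\<rparr>
       (insert (New k A B) (set A \<union> set B)))"
  by pat_completeness auto
termination by (relation "Wellfounded.measure (\<lambda>(\<F>, R, t). size t)") (auto simp del: tm.size)

declare valid.simps(2) [simp del]

text \<open>The membership in \<open>W\<close> that controls a link is that of one of its own
  ends.\<close>

lemma induced_links_cong:
  assumes "W \<inter> U = W' \<inter> U"
  shows "induced \<lparr>vertices = UNIV, edges = links R W\<rparr> U = induced \<lparr>vertices = UNIV, edges = links R W'\<rparr> U"
  unfolding induced_def using assms by (auto simp: links_def)

lemma valid_New: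
  "valid \<F> R (New k A B) \<longleftrightarrow> set A \<inter> set B = {} \<and>
     free_of \<F> (induced \<lparr>vertices = UNIV, edges = links R (insert (New k A B) (Collect (valid \<F> R)))\<rparr>
       (insert (New k A B) (set A \<union> set B)))"
  unfolding valid.simps(2) by (subst induced_links_cong) auto

section \<open>Relabelling base vertices and shifting indices\<close>

fun relabel :: "('a \<Rightarrow> 'b) \<Rightarrow> int \<Rightarrow> 'a tm \<Rightarrow> 'b tm" where
  "relabel g j (Base a) = Base (g a)"
| "relabel g j (New k A B) = New (k + j) (map (relabel g j) A) (map (relabel g j) B)"

lemma relabel_relabel: "relabel g i (relabel h j t) = relabel (g \<circ> h) (i + j) t"
  by (induction t) auto

lemma relabel_id [simp]: "relabel id 0 t = t"
  by (induction t) (auto simp: map_idI)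

lemma relabel_inj: "inj_on g S \<Longrightarrow> inj_on (relabel g j) {t. atoms_of t \<subseteq> S}"
proof (rule inj_onI, unfold mem_Collect_eq)
  fix s t assume g: "inj_on g S"
  show "atoms_of s \<subseteq> S \<Longrightarrow> atoms_of t \<subseteq> S \<Longrightarrow> relabel g j s = relabel g j t \<Longrightarrow> s = t"
  proof (induction s arbitrary: t)
    case (Base a)
    then show ?case using g by (cases t) (auto simp: inj_on_def)
  next
    case (New k A B)
    from New.prems obtain A' B' where t: "t = New k A' B'" by (cases t) auto
    have "A = A'" if "map (relabel g j) A = map (relabel g j) A'"
      using that New.IH(1) New.prems(1,2) unfolding t
      by (intro list.inj_map_strong[OF _ that]) (auto simp: UN_subset_iff)
    moreover have "B = B'" if "map (relabel g j) B = map (relabel g j) B'"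
      using that New.IH(2) New.prems(1,2) unfolding t
      by (intro list.inj_map_strong[OF _ that]) (auto simp: UN_subset_iff)
    ultimately show ?case using New.prems t by auto
  qed
qed

lemma relabel_mem_iff:
  assumes "inj_on g S" "atoms_of s \<subseteq> S" "\<And>u. u \<in> set A \<Longrightarrow> atoms_of u \<subseteq> S"
  shows "relabel g j s \<in> relabel g j ` set A \<longleftrightarrow> s \<in> set A"
  using inj_on_image_mem_iff[OF relabel_inj[OF assms(1), of j], of s "set A"] assms by auto

text \<open>\<open>W\<close> and \<open>W'\<close> are asked to correspond at the two ends only: in
  the induction for validity this is known just inside one neighbourhood.\<close>

lemma links_relabel:
  assumes g: "inj_on g S" and R: "\<And>a b. a \<in> S \<Longrightarrow> b \<in> S \<Longrightarrow> R' (g a, g b) = R (a, b)"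
    and s: "atoms_of s \<subseteq> S" "relabel g j s \<in> W' \<longleftrightarrow> s \<in> W"
    and t: "atoms_of t \<subseteq> S" "relabel g j t \<in> W' \<longleftrightarrow> t \<in> W"
  shows "(relabel g j s, relabel g j t) \<in> links R' W' \<longleftrightarrow> (s, t) \<in> links R W"
proof (cases s)
  case sB: (Base a)
  show ?thesis
  proof (cases t)
    case (Base b)
    then show ?thesis using s t R sB by auto
  next
    case (New k A B)
    have "relabel g j s \<in> relabel g j ` set A \<longleftrightarrow> s \<in> set A"
      by (rule relabel_mem_iff[OF g]) (use s t New in auto)
    then show ?thesis using s t New sB by auto
  qed
next
  case sN: (New k A B)
  have st: "relabel g j t \<in> relabel g j ` set B \<longleftrightarrow> t \<in> set B"
    by (rule relabel_mem_iff[OF g]) (use s t sN in auto)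
  show ?thesis
  proof (cases t)
    case (Base b)
    then show ?thesis using s t st sN by auto
  next
    case (New k' A' B')
    have "relabel g j s \<in> relabel g j ` set A' \<longleftrightarrow> s \<in> set A'"
      by (rule relabel_mem_iff[OF g]) (use s t New in auto)
    with st show ?thesis using s t New sN by auto
  qed
qed

text \<open>By induction the listed neighbours keep their validity, so relabelling carries the
  digraph tested for a term isomorphically onto the one tested for its image.\<close>

lemma valid_relabel:
  assumes g: "inj_on g S" and R: "\<And>a b. a \<in> S \<Longrightarrow> b \<in> S \<Longrightarrow> R' (g a, g b) = R (a, b)"
  shows "atoms_of t \<subseteq> S \<Longrightarrow> valid \<F> R' (relabel g j t) \<longleftrightarrow> valid \<F> R t"
proof (induction t)
  case (New k A B)
  define t where "t = New k A B"
  define U where "U = insert t (set A \<union> set B)"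
  define W where "W = insert t (Collect (valid \<F> R))"
  define W' where "W' = insert (relabel g j t) (Collect (valid \<F> R'))"
  have US: "U \<subseteq> {t. atoms_of t \<subseteq> S}" using New.prems by (auto simp: U_def t_def)
  have inj: "inj_on (relabel g j) U" using inj_on_subset[OF relabel_inj[OF g] US] .
  \<comment> \<open>The term under test lies in both sets by insertion, whatever its validity;
    injectivity keeps the images of the other neighbours apart from it.\<close>
  have W: "relabel g j s \<in> W' \<longleftrightarrow> s \<in> W" if "s \<in> U" for s
  proof (cases "s = t")
    case False
    then have "relabel g j s \<noteq> relabel g j t" using inj that by (auto simp: inj_on_def U_def)
    then show ?thesis using False that New.IH US by (auto simp: W_def W'_def U_def)
  qed (simp add: W_def W'_def)
  have atoms: "atoms_of s \<subseteq> S" if "s \<in> U" for s using US that by auto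
  have "(relabel g j s, relabel g j u) \<in> links R' W' \<longleftrightarrow> (s, u) \<in> links R W"
    if "s \<in> U" "u \<in> U" for s u
    using that by (intro links_relabel[where S=S] g R atoms W)
  with inj have "emb (relabel g j) (induced \<lparr>vertices = UNIV, edges = links R W\<rparr> U)
          (induced \<lparr>vertices = UNIV, edges = links R' W'\<rparr> (relabel g j ` U))"
    unfolding emb_def by auto
  then have "free_of \<F> (induced \<lparr>vertices = UNIV, edges = links R W\<rparr> U) \<longleftrightarrow>
      free_of \<F> (induced \<lparr>vertices = UNIV, edges = links R' W'\<rparr> (relabel g j ` U))"
    by (rule free_of_cong_emb) simp
  moreover have "set A \<inter> set B = {} \<longleftrightarrow> relabel g j ` set A \<inter> relabel g j ` set B = {}"
    using inj by (auto simp: U_def inj_on_def)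
  ultimately show ?case
    by (simp add: valid_New U_def W_def W'_def t_def image_Un)
qed simp

section \<open>The extension as a free saturated digraph\<close>

definition ext_digraph :: "'t oriented set \<Rightarrow> ('a \<times> 'a \<Rightarrow> bool) \<Rightarrow> 'a tm oriented" where
  "ext_digraph \<F> R = \<lparr>vertices = UNIV, edges = links R (Collect (valid \<F> R))\<rparr>"

lemma vertices_ext_digraph [simp]: "vertices (ext_digraph \<F> R) = UNIV"
  by (simp add: ext_digraph_def)

lemma edges_ext_digraph_Base [simp]: "(Base a, Base b) \<in> edges (ext_digraph \<F> R) \<longleftrightarrow> R (a, b)"
  by (simp add: ext_digraph_def)

text \<open>Three uses: \<open>g = id\<close>, \<open>j = 1\<close> makes the shift an automorphism;
  \<open>j = 0\<close> with a digraph isomorphism \<open>g\<close> yields the conjugating map;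
  \<open>g = id\<close>, \<open>j = 0\<close> with a finite \<open>S\<close> says that an edge
  depends on \<open>R\<close> only at the base vertices occurring in its ends.\<close>

lemma edges_ext_digraph_relabel:
  assumes "inj_on g S" "\<And>a b. a \<in> S \<Longrightarrow> b \<in> S \<Longrightarrow> R' (g a, g b) = R (a, b)"
    and "atoms_of s \<subseteq> S" "atoms_of t \<subseteq> S"
  shows "(relabel g j s, relabel g j t) \<in> edges (ext_digraph \<F> R') \<longleftrightarrow>
    (s, t) \<in> edges (ext_digraph \<F> R)"
  unfolding ext_digraph_def oriented.simps
  by (rule links_relabel[where S=S]) (simp_all add: assms valid_relabel[where S=S and R=R])

text \<open>A listed term is smaller than the term listing it, so the larger end of a link is the
  one that lists the other. Size plays the part of the order in which vertices are added.\<close>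

lemma link_cases:
  assumes "(s, t) \<in> edges (ext_digraph \<F> R) \<or> (t, s) \<in> edges (ext_digraph \<F> R)" "size s \<le> size t"
  shows "(\<exists>a b. s = Base a \<and> t = Base b) \<or>
    (\<exists>k A B. t = New k A B \<and> valid \<F> R t \<and> s \<in> set A \<union> set B)"
proof -
  have no: "\<not> (s = New k A B \<and> t \<in> set A \<union> set B)" for k A B
    using assms(2) size_mem[of t A k B] size_mem(2)[of t B k A] by (auto simp del: size_mem tm.size)
  show ?thesis using assms(1) no by (cases s; cases t) (auto simp: ext_digraph_def)
qed

text \<open>In a two-cycle through a new vertex the smaller end would occur in both lists of the
  larger one, but valid terms have disjoint lists.\<close>

lemma is_digraph_ext_digraph:
  assumes R: "irrefl (Collect R)" "antisym (Collect R)"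
  shows "is_digraph (ext_digraph \<F> R)"
  unfolding is_digraph_def
proof (intro conjI)
  let ?E = "edges (ext_digraph \<F> R)"
  show "irrefl ?E"
  proof (rule irreflI)
    fix t
    show "(t, t) \<notin> ?E"
    proof
      assume "(t, t) \<in> ?E"
      with link_cases[of t t \<F> R] show False
        using size_mem less_irrefl R(1) by (fastforce simp: irrefl_def simp del: size_mem tm.size)
    qed
  qed
  have le: "s = t" if st: "(s, t) \<in> ?E" "(t, s) \<in> ?E" "size s \<le> size t" for s t
  proof -
    consider a b where "s = Base a" "t = Base b"
      | k A B where "t = New k A B" "valid \<F> R t" "s \<in> set A \<union> set B"
      using link_cases[of s t \<F> R] st by blast
    then show ?thesis
    proof cases
      case 1
      then show ?thesis using st R(2) by (auto simp: antisym_def)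
    next
      case 2
      then have "set A \<inter> set B = {}" by (simp add: valid_New)
      moreover have "t \<notin> set A' \<union> set B'" if "s = New k' A' B'" for k' A' B'
        using \<open>size s \<le> size t\<close> that size_mem[of t A' k' B'] size_mem(2)[of t B' k' A']
        by (auto simp del: size_mem tm.size)
      ultimately show ?thesis using st 2(1) by (cases s) (auto simp: ext_digraph_def)
    qed
  qed
  show "antisym ?E" by (rule antisymI) (metis le nat_le_linear)
qed simp

text \<open>A vertex of greatest size in a supposed copy is joined to all others. So either the copy
  consists of base vertices and lies in \<open>R\<close>, or all other vertices are listed by the
  top term, whose validity excludes the copy.\<close>

lemma free_of_ext_digraph:
  assumes F: "\<And>T. T \<in> \<F> \<Longrightarrow> is_tournament T \<and> finite (vertices T) \<and> card (vertices T) \<ge> 3"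
    and R: "free_of \<F> \<lparr>vertices = UNIV, edges = Collect R\<rparr>"
  shows "free_of \<F> (ext_digraph \<F> R)"
  unfolding free_of_iff_emb
proof (intro ballI allI notI)
  fix T f assume T: "T \<in> \<F>" and f: "emb f T (ext_digraph \<F> R)"
  let ?E = "edges (ext_digraph \<F> R)"
  have fin: "finite (vertices T)" and card: "card (vertices T) \<ge> 3" using F[OF T] by auto
  then have ne: "vertices T \<noteq> {}" by auto
  obtain x where x: "x \<in> vertices T" "\<And>y. y \<in> vertices T \<Longrightarrow> size (f y) \<le> size (f x)"
    using Max_in[of "(size \<circ> f) ` vertices T"] Max_ge[of "(size \<circ> f) ` vertices T"] fin ne by fastforce
  have adj: "(f x, f y) \<in> ?E \<or> (f y, f x) \<in> ?E" if "y \<in> vertices T" "y \<noteq> x" for y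
    using F[OF T] f that x(1) by (auto simp: is_tournament_def total_on_def emb_def)
  have lc: "(\<exists>a b. f y = Base a \<and> f x = Base b) \<or>
    (\<exists>k A B. f x = New k A B \<and> valid \<F> R (f x) \<and> f y \<in> set A \<union> set B)"
    if "y \<in> vertices T" "y \<noteq> x" for y
    using link_cases[of "f y" "f x" \<F> R] adj[OF that] x(2)[OF that(1)] by blast
  \<comment> \<open>The link from a second vertex to a top vertex of the form
    \<open>New k A B\<close> certifies that the latter is valid.\<close>
  have "\<not> vertices T \<subseteq> {x}" using card card_mono[of "{x}" "vertices T"] by auto
  then obtain y where y: "y \<in> vertices T" "y \<noteq> x" by blast
  show False
  proof (cases "f x")
    case (Base a)
    then have "\<exists>a. f z = Base a" if "z \<in> vertices T" for z using lc[of z] that by (cases "z = x") auto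
    then have "\<forall>z\<in>vertices T. \<exists>a. f z = Base a" by blast
    then obtain h where h: "\<And>z. z \<in> vertices T \<Longrightarrow> f z = Base (h z)" by metis
    have "emb h T \<lparr>vertices = UNIV, edges = Collect R\<rparr>"
      using f by (auto simp: emb_def h inj_on_def)
    then show False using R T by (auto simp: free_of_iff_emb)
  next
    case (New k A B)
    have v: "valid \<F> R (New k A B)" using lc[OF y] New by auto
    then have "insert (New k A B) (Collect (valid \<F> R)) = Collect (valid \<F> R)" by auto
    with v have "free_of \<F> (induced (ext_digraph \<F> R) (insert (New k A B) (set A \<union> set B)))"
      by (simp add: valid_New ext_digraph_def)
    moreover have "f ` vertices T \<subseteq> insert (New k A B) (set A \<union> set B)"
      using lc New by fastforce
    then have "emb f T (induced (ext_digraph \<F> R) (insert (New k A B) (set A \<union> set B)))"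
      using f by (auto simp: emb_def)
    ultimately show False using T by (auto simp: free_of_iff_emb)
  qed
qed

primrec children :: "'a tm \<Rightarrow> 'a tm set" where
  "children (Base a) = {}"
| "children (New k A B) = set A \<union> set B"

lemma finite_children [simp]: "finite (children t)"
  by (cases t) auto

text \<open>The point to add is a term listing the images of the in- and out-neighbours of
  \<open>v\<close>. Its tested neighbourhood embeds into a copy of \<open>H\<close>, so freeness of
  \<open>H\<close> makes it valid.\<close>

lemma saturated_ext_digraph: "saturated \<F> (ext_digraph \<F> R)"
  unfolding saturated_def
proof (intro allI impI, elim conjE)
  fix H :: "nat oriented" and v e
  assume H: "is_digraph H" "finite (vertices H)" "free_of \<F> H" "v \<in> vertices H"
    and e: "emb e (induced H (vertices H - {v})) (ext_digraph \<F> R)"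
  let ?E = "edges (ext_digraph \<F> R)"
  define X where "X = e ` (vertices H - {v})"
  obtain A where A: "set A = e ` {u \<in> vertices H - {v}. (u, v) \<in> edges H}"
    using finite_list[of "e ` {u \<in> vertices H - {v}. (u, v) \<in> edges H}"] H(2) by auto
  obtain B where B: "set B = e ` {u \<in> vertices H - {v}. (v, u) \<in> edges H}"
    using finite_list[of "e ` {u \<in> vertices H - {v}. (v, u) \<in> edges H}"] H(2) by auto
  have e': "inj_on e (vertices H - {v})"
    "\<And>x y. x \<in> vertices H \<Longrightarrow> y \<in> vertices H \<Longrightarrow> x \<noteq> v \<Longrightarrow> y \<noteq> v \<Longrightarrow>
      (e x, e y) \<in> ?E \<longleftrightarrow> (x, y) \<in> edges H"
    using e by (auto simp: emb_def)
  have dis: "set A \<inter> set B = {}"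
    using H(1) e'(1) unfolding A B is_digraph_def irrefl_def antisym_def inj_on_def by blast
  \<comment> \<open>The index is chosen so that the new term is neither in \<open>X\<close> nor
    listed by a member of \<open>X\<close>; otherwise it could have links beyond the prescribed
    ones.\<close>
  have "finite (X \<union> \<Union> (children ` X))" using H(2) by (simp add: X_def)
  moreover have "inj (\<lambda>k. New k A B)" by (rule injI) simp
  then have "infinite (range (\<lambda>k. New k A B))" by (simp add: finite_image_iff infinite_UNIV_int)
  ultimately obtain k where k: "New k A B \<notin> X \<union> \<Union> (children ` X)"
    by (meson finite_subset image_subset_iff)
  define t where "t = New k A B"
  have tX: "t \<notin> X" "\<And>u. u \<in> X \<Longrightarrow> t \<notin> children u" using k by (auto simp: t_def)
  define f where "f = e(v := t)"
  have inj: "inj_on f (vertices H)"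
    using e'(1) tX(1) by (auto simp: f_def inj_on_def X_def)
  have tt: "t \<notin> set A" "t \<notin> set B"
    using tX(1) by (auto simp: A B X_def)
  have in_iff: "(f u, t) \<in> links R (insert t (Collect (valid \<F> R))) \<longleftrightarrow> (u, v) \<in> edges H"
    "(t, f u) \<in> links R (insert t (Collect (valid \<F> R))) \<longleftrightarrow> (v, u) \<in> edges H"
    if u: "u \<in> vertices H" for u
  proof -
    have *: "((f u, t) \<in> links R (insert t (Collect (valid \<F> R))) \<longleftrightarrow> (u, v) \<in> edges H) \<and>
      ((t, f u) \<in> links R (insert t (Collect (valid \<F> R))) \<longleftrightarrow> (v, u) \<in> edges H)"
    proof (cases "u = v")
      case True
      then have "f u = t" by (simp add: f_def)
      moreover have "(v, v) \<notin> edges H" using H(1) by (simp add: is_digraph_def irrefl_def)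
      moreover have "(t, t) \<notin> links R (insert t (Collect (valid \<F> R)))"
        using tt unfolding t_def by simp
      ultimately show ?thesis using True by simp
    next
      case False
      then have fu: "f u = e u" "e u \<in> X" using u by (auto simp: f_def X_def)
      have "e u \<in> set A \<longleftrightarrow> (u, v) \<in> edges H" "e u \<in> set B \<longleftrightarrow> (v, u) \<in> edges H"
        using e'(1) u False by (auto simp: A B inj_on_def)
      then show ?thesis using tX(2)[OF fu(2)] unfolding fu(1) by (cases "e u") (auto simp: t_def)
    qed
    show "(f u, t) \<in> links R (insert t (Collect (valid \<F> R))) \<longleftrightarrow> (u, v) \<in> edges H"
      "(t, f u) \<in> links R (insert t (Collect (valid \<F> R))) \<longleftrightarrow> (v, u) \<in> edges H" using * by auto
  qed
  have old: "(e u, e w) \<in> links R (insert t (Collect (valid \<F> R))) \<longleftrightarrow> (u, w) \<in> edges H"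
    if "u \<in> vertices H - {v}" "w \<in> vertices H - {v}" for u w
  proof -
    have "e u \<noteq> t" "e w \<noteq> t" using tX(1) that by (auto simp: X_def)
    then have "(e u, e w) \<in> links R (insert t (Collect (valid \<F> R))) \<longleftrightarrow> (e u, e w) \<in> ?E"
      by (auto simp: ext_digraph_def links_def)
    then show ?thesis using e'(2) that by auto
  qed
  \<comment> \<open>The embedding is first shown with the links of \<open>t\<close> switched on by
    force. It then yields validity of \<open>t\<close>, after which the insertion changes
    nothing.\<close>
  have emb: "emb f H \<lparr>vertices = UNIV, edges = links R (insert t (Collect (valid \<F> R)))\<rparr>"
  proof -
    have "(u, w) \<in> edges H \<longleftrightarrow> (f u, f w) \<in> links R (insert t (Collect (valid \<F> R)))"
      if "u \<in> vertices H" "w \<in> vertices H" for u w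
    proof (cases "u = v \<or> w = v")
      case True
      then show ?thesis using in_iff(1)[OF that(1)] in_iff(2)[OF that(2)] by (auto simp: f_def)
    next
      case False
      then show ?thesis using old[of u w] that by (simp add: f_def)
    qed
    then show ?thesis using inj by (simp add: emb_def)
  qed
  let ?D = "induced \<lparr>vertices = UNIV, edges = links R (insert t (Collect (valid \<F> R)))\<rparr> (f ` vertices H)"
  have "emb f H ?D" using emb by (auto simp: emb_def)
  then have "free_of \<F> ?D" using H(3) free_of_cong_emb by (metis vertices_induced)
  moreover have "insert t (set A \<union> set B) \<subseteq> f ` vertices H"
    using H(4) by (auto simp: A B f_def)
  then have "emb id (induced \<lparr>vertices = UNIV, edges = links R (insert t (Collect (valid \<F> R)))\<rparr>
      (insert t (set A \<union> set B))) ?D"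
    by (auto simp: emb_def)
  ultimately have "valid \<F> R t" unfolding t_def valid_New using dis free_of_emb by blast
  then have "insert t (Collect (valid \<F> R)) = Collect (valid \<F> R)" by auto
  with emb have "emb f H (ext_digraph \<F> R)" by (simp add: ext_digraph_def)
  then show "\<exists>w. emb (e(v := w)) H (ext_digraph \<F> R)" unfolding f_def ..
qed

subsection \<open>Automorphism groups\<close>

lemma AutD:
  assumes "\<phi> \<in> Aut D"
  shows "bij_betw \<phi> (vertices D) (vertices D)"
    and "x \<in> vertices D \<Longrightarrow> \<phi> x \<in> vertices D"
    and "x \<in> vertices D \<Longrightarrow> y \<in> vertices D \<Longrightarrow> (\<phi> x, \<phi> y) \<in> edges D \<longleftrightarrow> (x, y) \<in> edges D"
    and "\<phi> \<in> extensional (vertices D)"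
  using assms unfolding Aut_def digraph_iso_def by (auto simp: bij_betw_apply)

lemma AutI:
  assumes "\<phi> \<in> extensional (vertices D)" "bij_betw \<phi> (vertices D) (vertices D)"
    and "\<And>x y. x \<in> vertices D \<Longrightarrow> y \<in> vertices D \<Longrightarrow> (\<phi> x, \<phi> y) \<in> edges D \<longleftrightarrow> (x, y) \<in> edges D"
  shows "\<phi> \<in> Aut D"
  using assms unfolding Aut_def digraph_iso_def by blast

lemma Aut_subset_Bij: "Aut D \<subseteq> Bij (vertices D)"
  by (auto simp: Bij_def AutD)

lemma subgroup_Aut: "subgroup (Aut D) (BijGroup (vertices D))"
proof (rule group.subgroupI[OF group_BijGroup])
  show "Aut D \<subseteq> carrier (BijGroup (vertices D))"
    using Aut_subset_Bij by (simp add: BijGroup_def)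
  have "(\<lambda>x\<in>vertices D. x) \<in> Aut D"
    by (rule AutI) (auto intro!: bij_betwI[where g = "\<lambda>x. x"])
  then show "Aut D \<noteq> {}" by blast
  show "inv\<^bsub>BijGroup (vertices D)\<^esub> \<phi> \<in> Aut D" if \<phi>: "\<phi> \<in> Aut D" for \<phi>
  proof -
    note b = AutD(1)[OF \<phi>]
    have m: "inv_into (vertices D) \<phi> x \<in> vertices D" "\<phi> (inv_into (vertices D) \<phi> x) = x"
      if "x \<in> vertices D" for x
      using b that by (auto simp: bij_betw_def inv_into_into f_inv_into_f)
    have "(\<lambda>x\<in>vertices D. inv_into (vertices D) \<phi> x) \<in> Aut D"
    proof (rule AutI)
      have "bij_betw (inv_into (vertices D) \<phi>) (vertices D) (vertices D)"
        using b by (rule bij_betw_inv_into)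
      then show "bij_betw (\<lambda>x\<in>vertices D. inv_into (vertices D) \<phi> x) (vertices D) (vertices D)"
        by (simp cong: bij_betw_cong)
      fix x y assume xy: "x \<in> vertices D" "y \<in> vertices D"
      show "((\<lambda>x\<in>vertices D. inv_into (vertices D) \<phi> x) x, (\<lambda>x\<in>vertices D. inv_into (vertices D) \<phi> x) y)
        \<in> edges D \<longleftrightarrow> (x, y) \<in> edges D"
        using AutD(3)[OF \<phi> m(1)[OF xy(1)] m(1)[OF xy(2)]] m xy by simp
    qed simp
    moreover have "\<phi> \<in> Bij (vertices D)" using \<phi> Aut_subset_Bij by blast
    ultimately show ?thesis by (simp add: inv_BijGroup)
  qed
  show "\<phi> \<otimes>\<^bsub>BijGroup (vertices D)\<^esub> \<psi> \<in> Aut D" if "\<phi> \<in> Aut D" "\<psi> \<in> Aut D" for \<phi> \<psi>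
  proof -
    have "\<phi> \<in> Bij (vertices D)" "\<psi> \<in> Bij (vertices D)" using that Aut_subset_Bij by blast+
    moreover have "compose (vertices D) \<phi> \<psi> \<in> Aut D"
      using that bij_betw_trans[OF AutD(1)[OF that(2)] AutD(1)[OF that(1)]]
      by (intro AutI) (simp_all add: AutD compose_def comp_def cong: bij_betw_cong)
    ultimately show ?thesis by (simp add: BijGroup_def)
  qed
qed

lemma group_aut_group: "group (aut_group D)"
  unfolding aut_group_def
  by (rule subgroup.subgroup_is_group[OF subgroup_Aut group_BijGroup])

text \<open>Multiplying by \<delta> from the right removes the inverse and leaves an equation
  between composites that are undefined outside the vertex set.\<close>

lemma conjugate_aut_group:
  assumes "\<phi> \<in> Aut D" "\<psi> \<in> Aut D"
  shows "conjugate (aut_group D) \<phi> \<psi> \<longleftrightarrow>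
    (\<exists>\<delta>\<in>Aut D. \<forall>x\<in>vertices D. \<psi> (\<delta> x) = \<delta> (\<phi> x))"
proof -
  interpret group "aut_group D" by (rule group_aut_group)
  have car: "carrier (aut_group D) = Aut D" by (simp add: aut_group_def)
  have mult: "\<alpha> \<otimes>\<^bsub>aut_group D\<^esub> \<beta> = compose (vertices D) \<alpha> \<beta>" if "\<alpha> \<in> Aut D" "\<beta> \<in> Aut D" for \<alpha> \<beta>
    using that Aut_subset_Bij[of D] by (auto simp: aut_group_def BijGroup_def)
  have "\<psi> = \<delta> \<otimes>\<^bsub>aut_group D\<^esub> \<phi> \<otimes>\<^bsub>aut_group D\<^esub> inv\<^bsub>aut_group D\<^esub> \<delta> \<longleftrightarrow>
    (\<forall>x\<in>vertices D. \<psi> (\<delta> x) = \<delta> (\<phi> x))" if \<delta>: "\<delta> \<in> Aut D" for \<delta>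
  proof -
    have "\<psi> = \<delta> \<otimes>\<^bsub>aut_group D\<^esub> \<phi> \<otimes>\<^bsub>aut_group D\<^esub> inv\<^bsub>aut_group D\<^esub> \<delta> \<longleftrightarrow>
        \<psi> \<otimes>\<^bsub>aut_group D\<^esub> \<delta> = \<delta> \<otimes>\<^bsub>aut_group D\<^esub> \<phi>"
      using assms \<delta> unfolding car[symmetric]
      by (metis inv_closed inv_solve_right m_closed)
    also have "\<dots> \<longleftrightarrow> compose (vertices D) \<psi> \<delta> = compose (vertices D) \<delta> \<phi>"
      using assms \<delta> by (simp add: mult)
    also have "\<dots> \<longleftrightarrow> (\<forall>x\<in>vertices D. \<psi> (\<delta> x) = \<delta> (\<phi> x))"
      by (auto simp: compose_def fun_eq_iff restrict_def)
    finally show ?thesis .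
  qed
  then show ?thesis unfolding conjugate_def car by blast
qed

subsection \<open>Reduction to conjugacy\<close>

text \<open>The preimage of any set is a union of cylinders over finite conditions, and there are
  only countably many of these.\<close>

lemma measurable_locally_determined:
  fixes f :: "('i \<Rightarrow> bool) \<Rightarrow> 'b"
  assumes I: "countable I" and f: "\<And>x. x \<in> S \<Longrightarrow> f x \<in> A"
    and local: "\<And>x. x \<in> S \<Longrightarrow> \<exists>J. finite J \<and> J \<subseteq> I \<and> (\<forall>y\<in>S. (\<forall>i\<in>J. y i = x i) \<longrightarrow> f y = f x)"
  shows "f \<in> measurable (restrict_space (Pi\<^sub>M I (\<lambda>_. count_space UNIV)) S) (count_space A)"
proof (rule measurableI)
  let ?M = "Pi\<^sub>M I (\<lambda>_. count_space (UNIV :: bool set))"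
  show "f x \<in> space (count_space A)" if "x \<in> space (restrict_space ?M S)" for x
    using that f by (auto simp: space_restrict_space)
  fix X assume "X \<in> sets (count_space A)"
  \<comment> \<open>A finite condition is a pair of finite sets: the coordinates \<open>J\<close>
    consulted, and \<open>P\<close> naming those that must be true. \<open>C\<close> collects the
    conditions that force the value into \<open>X\<close>.\<close>
  define cyl where "cyl = (\<lambda>(J, P). {y \<in> space ?M. \<forall>i\<in>J. y i \<longleftrightarrow> i \<in> P})"
  define C where "C = {(J, P). finite J \<and> J \<subseteq> I \<and> finite P \<and> P \<subseteq> I \<and>
     (\<forall>y\<in>S. (\<forall>i\<in>J. y i \<longleftrightarrow> i \<in> P) \<longrightarrow> f y \<in> X)}"
  have "C \<subseteq> {J. finite J \<and> J \<subseteq> I} \<times> {J. finite J \<and> J \<subseteq> I}" by (auto simp: C_def)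
  moreover have "countable {J. finite J \<and> J \<subseteq> I}" using I by (rule countable_Collect_finite_subset)
  ultimately have "countable C" using countable_SIGMA countable_subset by meson
  moreover have "cyl p \<in> sets ?M" if "p \<in> C" for p
  proof -
    obtain J P where p: "p = (J, P)" "finite J" "J \<subseteq> I" using \<open>p \<in> C\<close> by (auto simp: C_def)
    have "{y \<in> space ?M. y i \<longleftrightarrow> i \<in> P} \<in> sets ?M" if "i \<in> J" for i
    proof -
      have "i \<in> I" using that p by blast
      then have "(\<lambda>y. y i) \<in> measurable ?M (count_space UNIV)"
        by (rule measurable_component_singleton)
      from measurable_sets[OF this, of "{i \<in> P}"] show ?thesis
        by (simp add: vimage_def Int_def conj_commute)
    qed
    then show ?thesis using p(2) unfolding p(1) cyl_def by (auto intro: sets.sets_Collect_finite_All)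
  qed
  ultimately have "\<Union> (cyl ` C) \<in> sets ?M" by (intro sets.countable_UN') auto
  moreover have "f -` X \<inter> space (restrict_space ?M S) = S \<inter> \<Union> (cyl ` C)"
  proof (intro equalityI subsetI)
    fix y assume "y \<in> f -` X \<inter> space (restrict_space ?M S)"
    then have y: "y \<in> S" "y \<in> space ?M" "f y \<in> X" by (auto simp: space_restrict_space)
    from local[OF y(1)] obtain J where J: "finite J" "J \<subseteq> I"
      "\<forall>z\<in>S. (\<forall>i\<in>J. z i = y i) \<longrightarrow> f z = f y" by blast
    have "(J, {i \<in> J. y i}) \<in> C" using J y(3) by (auto simp: C_def)
    moreover have "y \<in> cyl (J, {i \<in> J. y i})" using y(2) by (auto simp: cyl_def)
    ultimately show "y \<in> S \<inter> \<Union> (cyl ` C)" using y(1) by blast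
  next
    fix y assume "y \<in> S \<inter> \<Union> (cyl ` C)"
    then show "y \<in> f -` X \<inter> space (restrict_space ?M S)"
      by (auto simp: cyl_def C_def space_restrict_space)
  qed
  ultimately show "f -` X \<inter> space (restrict_space ?M S) \<in> sets (restrict_space ?M S)"
    by (auto simp: sets_restrict_space)
qed

lemma bij_relabel:
  assumes "bij g"
  shows "bij (relabel g j)"
proof (rule o_bij)
  have eq: "g \<circ> inv_into UNIV g = id" "inv_into UNIV g \<circ> g = id" 
    using assms by (simp_all add: fun_eq_iff bij_is_inj bij_is_surj surj_f_inv_f)
  then show "relabel (inv_into UNIV g) (- j) \<circ> relabel g j = id" "relabel g j \<circ> relabel (inv_into UNIV g) (- j) = id"
    by (auto simp: relabel_relabel eq)
qed

lemma relabel_fixed_iff: "relabel id 1 t = t \<longleftrightarrow> (\<exists>a. t = Base a)"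
  by (cases t) auto

lemma finite_atoms_of [simp]: "finite (atoms_of t)"
  by (induction t) auto

context
  fixes \<F> :: "'t oriented set" and \<Gamma> :: "'v oriented"
  assumes F: "\<And>T. T \<in> \<F> \<Longrightarrow> is_tournament T \<and> finite (vertices T) \<and> card (vertices T) \<ge> 3"
    and generic: "is_generic \<F> \<Gamma>"
begin

abbreviation (input) "free_digraphs \<equiv> {R. is_digraph (digraph_on_nat R) \<and> free_of \<F> (digraph_on_nat R)}"

text \<open>A one-point digraph is free because forbidden tournaments are larger. Nonemptiness makes
  \<open>from_nat_into\<close> enumerate exactly the vertices of \<Gamma>.\<close>

lemma generic_nonempty: "vertices \<Gamma> \<noteq> {}"
proof -
  define H :: "nat oriented" where "H = \<lparr>vertices = {0}, edges = {}\<rparr>"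
  have "\<not> emb f T H" if "T \<in> \<F>" for T f
  proof
    assume "emb f T H"
    then have "card (vertices T) \<le> card {0 :: nat}"
      by (intro card_inj_on_le[of f]) (auto simp: emb_def H_def)
    then show False using F[OF that] by simp
  qed
  then have "free_of \<F> H" by (simp add: free_of_iff_emb)
  moreover have "is_digraph H" "finite (vertices H)"
    by (simp_all add: H_def is_digraph_def irrefl_def)
  ultimately have "has_induced_copy \<Gamma> H" using generic unfolding is_generic_def by blast
  then show ?thesis by (auto simp: has_induced_copy_iff_emb emb_def H_def)
qed

lemma back_forth_assms:
  assumes "R \<in> free_digraphs"
  shows "is_digraph (ext_digraph \<F> R)" "free_of \<F> (ext_digraph \<F> R)" "saturated \<F> (ext_digraph \<F> R)"
    "range (from_nat :: nat \<Rightarrow> nat tm) = vertices (ext_digraph \<F> R)"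
    "is_digraph \<Gamma>" "free_of \<F> \<Gamma>" "saturated \<F> \<Gamma>" "range (from_nat_into (vertices \<Gamma>)) = vertices \<Gamma>"
proof -
  show "is_digraph (ext_digraph \<F> R)"
    using assms by (intro is_digraph_ext_digraph) (auto simp: is_digraph_def digraph_on_nat_def)
  show "free_of \<F> (ext_digraph \<F> R)"
    using assms by (intro free_of_ext_digraph F) (auto simp: digraph_on_nat_def)
  show "free_of \<F> \<Gamma>" using generic_free[OF generic] F by blast
  show "range (from_nat_into (vertices \<Gamma>)) = vertices \<Gamma>"
    using generic generic_nonempty by (intro range_from_nat_into) (auto simp: is_generic_def)
qed (use generic in \<open>auto simp: is_generic_def saturated_ext_digraph generic_saturated\<close>)

abbreviation (input) "approx R \<equiv> back_forth from_nat (from_nat_into (vertices \<Gamma>)) (ext_digraph \<F> R) \<Gamma>"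
abbreviation (input) "gen_rel R \<equiv> limit_iso (ext_digraph \<F> R) \<Gamma> from_nat (from_nat_into (vertices \<Gamma>))"

section \<open>Transport of the shift to the generic digraph\<close>

definition gen_iso :: "(nat \<times> nat \<Rightarrow> bool) \<Rightarrow> nat tm \<Rightarrow> 'v" where
  "gen_iso R t = (THE v. (t, v) \<in> gen_rel R)"

lemma gen_iso:
  assumes "R \<in> free_digraphs"
  shows "(t, v) \<in> gen_rel R \<longleftrightarrow> gen_iso R t = v"
    and "emb (gen_iso R) (ext_digraph \<F> R) \<Gamma>" and "range (gen_iso R) = vertices \<Gamma>"
proof -
  note li = limit_iso[OF back_forth_assms[OF assms]]
  have ex: "\<exists>v. (t, v) \<in> gen_rel R" for t using li(2) by auto
  have iff: "(t, v) \<in> gen_rel R \<longleftrightarrow> gen_iso R t = v" for t v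
  proof -
    have "\<exists>!v. (t, v) \<in> gen_rel R" using ex[of t] partial_isoD(1)[OF li(1)] by blast
    then show ?thesis unfolding gen_iso_def by (metis theI')
  qed
  then show "(t, v) \<in> gen_rel R \<longleftrightarrow> gen_iso R t = v" .
  have mem: "(t, gen_iso R t) \<in> gen_rel R" for t using iff by blast
  have "range (gen_iso R) = Range (gen_rel R)" using iff by auto
  then show r: "range (gen_iso R) = vertices \<Gamma>" by (simp only: li(3))
  show "emb (gen_iso R) (ext_digraph \<F> R) \<Gamma>"
    unfolding emb_def using partial_isoD[OF li(1) mem mem] r by (auto intro!: injI)
qed

lemma gen_iso_simps:
  assumes "R \<in> free_digraphs"
  shows "inj (gen_iso R)" "inv_into UNIV (gen_iso R) (gen_iso R t) = t"
    "v \<in> vertices \<Gamma> \<Longrightarrow> gen_iso R (inv_into UNIV (gen_iso R) v) = v" "gen_iso R t \<in> vertices \<Gamma>"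
    "(gen_iso R s, gen_iso R t) \<in> edges \<Gamma> \<longleftrightarrow> (s, t) \<in> edges (ext_digraph \<F> R)"
  using gen_iso(2,3)[OF assms] by (auto simp: emb_def f_inv_into_f inv_f_f)

definition shift_aut :: "(nat \<times> nat \<Rightarrow> bool) \<Rightarrow> 'v \<Rightarrow> 'v" where
  "shift_aut R = (\<lambda>v\<in>vertices \<Gamma>. gen_iso R (relabel id 1 (inv_into UNIV (gen_iso R) v)))"

lemma shift_aut_gen_iso:
  "R \<in> free_digraphs \<Longrightarrow> shift_aut R (gen_iso R t) = gen_iso R (relabel id 1 t)"
  by (simp add: shift_aut_def gen_iso_simps)

text \<open>Used twice: with \<open>S = R\<close> and the index shift it gives
  \<open>shift_aut R\<close>; with the relabelling along an isomorphism from \<open>R\<close> to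
  \<open>S\<close> it gives the conjugating automorphism.\<close>

lemma transported_Aut:
  assumes R: "R \<in> free_digraphs" and S: "S \<in> free_digraphs" and \<theta>: "bij \<theta>"
    and E: "\<And>s t. (\<theta> s, \<theta> t) \<in> edges (ext_digraph \<F> S) \<longleftrightarrow> (s, t) \<in> edges (ext_digraph \<F> R)"
  shows "(\<lambda>v\<in>vertices \<Gamma>. gen_iso S (\<theta> (inv_into UNIV (gen_iso R) v))) \<in> Aut \<Gamma>"
proof (rule AutI)
  note iR = gen_iso_simps[OF R] and iS = gen_iso_simps[OF S]
  have "bij_betw (\<lambda>v. gen_iso S (\<theta> (inv_into UNIV (gen_iso R) v))) (vertices \<Gamma>) (vertices \<Gamma>)"
  proof (rule bij_betwI[where g = "\<lambda>v. gen_iso R (inv_into UNIV \<theta> (inv_into UNIV (gen_iso S) v))"])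
  qed (use iR iS \<theta> in \<open>auto simp: bij_is_inj bij_is_surj surj_f_inv_f\<close>)
  then show "bij_betw (\<lambda>v\<in>vertices \<Gamma>. gen_iso S (\<theta> (inv_into UNIV (gen_iso R) v))) (vertices \<Gamma>) (vertices \<Gamma>)"
    by (simp cong: bij_betw_cong)
  fix x y assume xy: "x \<in> vertices \<Gamma>" "y \<in> vertices \<Gamma>"
  then show "((\<lambda>v\<in>vertices \<Gamma>. gen_iso S (\<theta> (inv_into UNIV (gen_iso R) v))) x,
      (\<lambda>v\<in>vertices \<Gamma>. gen_iso S (\<theta> (inv_into UNIV (gen_iso R) v))) y) \<in> edges \<Gamma> \<longleftrightarrow> (x, y) \<in> edges \<Gamma>"
    using iR(5)[of "inv_into UNIV (gen_iso R) x" "inv_into UNIV (gen_iso R) y"] by (simp add: iS(5) E iR(3))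
qed simp

lemma shift_aut_Aut: "R \<in> free_digraphs \<Longrightarrow> shift_aut R \<in> Aut \<Gamma>"
  unfolding shift_aut_def
  by (rule transported_Aut, assumption+, rule bij_relabel[OF bij_id], rule edges_ext_digraph_relabel[where S=UNIV])
    simp_all

text \<open>Relabelling base vertices commutes with shifting indices, so an isomorphism induces a
  conjugation. Conversely, a conjugating automorphism, read on terms, commutes with the shift and so
  matches up its fixed points, the base vertices.\<close>

lemma shift_aut_conjugate_iff:
  assumes R: "R \<in> free_digraphs" and S: "S \<in> free_digraphs"
  shows "isomorphic_on_nat R S \<longleftrightarrow> conjugate (aut_group \<Gamma>) (shift_aut R) (shift_aut S)"
proof -
  note iR = gen_iso_simps[OF R] and iS = gen_iso_simps[OF S]
  have iso: "isomorphic_on_nat R S \<longleftrightarrow> (\<exists>g. bij g \<and> (\<forall>a b. S (g a, g b) = R (a, b)))"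
    by (auto simp: isomorphic_on_nat_def digraph_isomorphic_def digraph_iso_def digraph_on_nat_def)
  have conj: "conjugate (aut_group \<Gamma>) (shift_aut R) (shift_aut S) \<longleftrightarrow>
    (\<exists>\<delta>\<in>Aut \<Gamma>. \<forall>t. shift_aut S (\<delta> (gen_iso R t)) = \<delta> (gen_iso R (relabel id 1 t)))"
  proof -
    have "(\<forall>x\<in>vertices \<Gamma>. shift_aut S (\<delta> x) = \<delta> (shift_aut R x)) \<longleftrightarrow>
      (\<forall>t. shift_aut S (\<delta> (gen_iso R t)) = \<delta> (gen_iso R (relabel id 1 t)))" for \<delta>
      unfolding gen_iso(3)[OF R, symmetric] by (simp add: shift_aut_gen_iso[OF R])
    then show ?thesis using conjugate_aut_group[OF shift_aut_Aut[OF R] shift_aut_Aut[OF S]] by simp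
  qed
  show ?thesis unfolding iso conj
  proof
    assume "\<exists>g. bij g \<and> (\<forall>a b. S (g a, g b) = R (a, b))"
    then obtain g where g: "bij g" "\<And>a b. S (g a, g b) = R (a, b)" by blast
    define \<delta> where "\<delta> = (\<lambda>v\<in>vertices \<Gamma>. gen_iso S (relabel g 0 (inv_into UNIV (gen_iso R) v)))"
    have "\<delta> \<in> Aut \<Gamma>" unfolding \<delta>_def
      by (rule transported_Aut[OF R S])
        (use g in \<open>simp_all add: bij_relabel bij_is_inj edges_ext_digraph_relabel[where S=UNIV and R=R]\<close>)
    moreover have "shift_aut S (\<delta> (gen_iso R t)) = \<delta> (gen_iso R (relabel id 1 t))" for t
      by (simp add: \<delta>_def iR shift_aut_gen_iso[OF S] relabel_relabel)
    ultimately show "\<exists>\<delta>\<in>Aut \<Gamma>. \<forall>t. shift_aut S (\<delta> (gen_iso R t)) = \<delta> (gen_iso R (relabel id 1 t))"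
      by blast
  next
    assume "\<exists>\<delta>\<in>Aut \<Gamma>. \<forall>t. shift_aut S (\<delta> (gen_iso R t)) = \<delta> (gen_iso R (relabel id 1 t))"
    then obtain \<delta> where \<delta>: "\<delta> \<in> Aut \<Gamma>"
      "\<And>t. shift_aut S (\<delta> (gen_iso R t)) = \<delta> (gen_iso R (relabel id 1 t))" by blast
    define \<theta> where "\<theta> t = inv_into UNIV (gen_iso S) (\<delta> (gen_iso R t))" for t
    have \<theta>: "gen_iso S (\<theta> t) = \<delta> (gen_iso R t)" for t
      using iS(3) AutD(2)[OF \<delta>(1) iR(4)] by (simp add: \<theta>_def)
    have comm: "\<theta> (relabel id 1 t) = relabel id 1 (\<theta> t)" for t
      using \<delta>(2)[of t] iS(1) by (simp add: \<theta>[symmetric] shift_aut_gen_iso[OF S] inj_eq)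
    have inj: "\<theta> s = \<theta> t \<longleftrightarrow> s = t" for s t
    proof
      assume "\<theta> s = \<theta> t"
      then have "\<delta> (gen_iso R s) = \<delta> (gen_iso R t)" by (simp flip: \<theta>)
      then show "s = t"
        using AutD(1)[OF \<delta>(1)] iR(4) iR(1) by (meson bij_betw_imp_inj_on inj_onD inj_eq)
    qed simp
    have surj: "\<exists>t. \<theta> t = s" for s
    proof -
      obtain v where v: "v \<in> vertices \<Gamma>" "\<delta> v = gen_iso S s"
        using AutD(1)[OF \<delta>(1)] iS(4)[of s] by (metis bij_betw_def imageE)
      then have "gen_iso S (\<theta> (inv_into UNIV (gen_iso R) v)) = gen_iso S s" by (simp add: \<theta> iR(3))
      then show ?thesis using iS(1) by (auto simp: inj_eq)
    qed
    \<comment> \<open>An injective map commuting with the shift preserves and reflects its fixed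
      points.\<close>
    have fixed: "(\<exists>b. \<theta> t = Base b) \<longleftrightarrow> (\<exists>a. t = Base a)" for t
      using comm[of t] inj relabel_fixed_iff by metis
    have "\<exists>b. \<theta> (Base a) = Base b" for a using fixed by blast
    then obtain g where g: "\<And>a. \<theta> (Base a) = Base (g a)" by metis
    have "g a = g b \<Longrightarrow> a = b" for a b using g inj by (metis tm.inject(1))
    moreover have "\<exists>a. g a = b" for b
    proof -
      obtain t where t: "\<theta> t = Base b" using surj by blast
      then obtain a where "t = Base a" using fixed by blast
      then show ?thesis using t g by auto
    qed
    ultimately have "bij g" by (metis bijI injI surjI)
    moreover have "S (g a, g b) = R (a, b)" for a b
    proof -
      have "S (g a, g b) \<longleftrightarrow> (\<theta> (Base a), \<theta> (Base b)) \<in> edges (ext_digraph \<F> S)" by (simp add: g)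
      also have "\<dots> \<longleftrightarrow> (gen_iso R (Base a), gen_iso R (Base b)) \<in> edges \<Gamma>"
        using AutD(3)[OF \<delta>(1) iR(4) iR(4)] by (simp flip: iS(5) add: \<theta>)
      finally show ?thesis by (simp add: iR(5))
    qed
    ultimately show "\<exists>g. bij g \<and> (\<forall>a b. S (g a, g b) = R (a, b))" by blast
  qed
qed

text \<open>If \<open>v\<close> is the image of the term \<open>s\<close>, the value at
  \<open>v\<close> is settled by two pairs of the limit, those of \<open>s\<close> and of the
  shifted \<open>s\<close>. Each appears at a finite stage, which sees finitely many edges between
  terms.\<close>

lemma shift_aut_local:
  assumes R: "R \<in> free_digraphs" and v: "v \<in> vertices \<Gamma>"
  shows "\<exists>J. finite J \<and> (\<forall>R'\<in>free_digraphs. (\<forall>i\<in>J. R' i = R i) \<longrightarrow> shift_aut R' v = shift_aut R v)"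
proof -
  define s where "s = inv_into UNIV (gen_iso R) v"
  define w where "w = gen_iso R (relabel id 1 s)"
  have sv: "gen_iso R s = v" using gen_iso_simps(3)[OF R v] by (simp add: s_def)
  have "(s, v) \<in> gen_rel R" "(relabel id 1 s, w) \<in> gen_rel R"
    using gen_iso(1)[OF R] sv w_def by blast+
  then obtain m n where mn: "(s, v) \<in> approx R m" "(relabel id 1 s, w) \<in> approx R n"
    unfolding limit_iso_def[OF back_forth_assms[OF R]] by blast
  have "\<exists>U. finite U \<and> (\<forall>D2. vertices D2 = vertices (ext_digraph \<F> R) \<and>
     (\<forall>x\<in>U. \<forall>y\<in>U. (x, y) \<in> edges D2 \<longleftrightarrow> (x, y) \<in> edges (ext_digraph \<F> R)) \<longrightarrow>
     back_forth from_nat (from_nat_into (vertices \<Gamma>)) D2 \<Gamma> k = approx R k)" for k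
    by (rule back_forth_local[OF back_forth_assms[OF R]])
  then obtain U where U: "\<And>k. finite (U k)" "\<And>k D2. vertices D2 = vertices (ext_digraph \<F> R) \<and>
     (\<forall>x\<in>U k. \<forall>y\<in>U k. (x, y) \<in> edges D2 \<longleftrightarrow> (x, y) \<in> edges (ext_digraph \<F> R)) \<longrightarrow>
     back_forth from_nat (from_nat_into (vertices \<Gamma>)) D2 \<Gamma> k = approx R k" by metis
  define J where "J = (\<Union>t\<in>U m \<union> U n. atoms_of t)"
  have "finite (J \<times> J)" using U(1) by (simp add: J_def)
  moreover have "shift_aut R' v = shift_aut R v"
    if R': "R' \<in> free_digraphs" and eq: "\<forall>i\<in>J \<times> J. R' i = R i" for R'
  proof -
    have "(s, t) \<in> edges (ext_digraph \<F> R') \<longleftrightarrow> (s, t) \<in> edges (ext_digraph \<F> R)"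
      if "s \<in> U m \<union> U n" "t \<in> U m \<union> U n" for s t
      using edges_ext_digraph_relabel[of id J R' R s t 0 \<F>] that eq by (auto simp: J_def)
    then have "approx R' m = approx R m" "approx R' n = approx R n"
      using U(2)[of "ext_digraph \<F> R'" m] U(2)[of "ext_digraph \<F> R'" n] by auto
    \<comment> \<open>The two pairs lie in stages shared by \<open>R\<close> and \<open>R'\<close>,
      hence in the limit for \<open>R'\<close> as well.\<close>
    then have "(s, v) \<in> gen_rel R'" "(relabel id 1 s, w) \<in> gen_rel R'"
      using mn unfolding limit_iso_def[OF back_forth_assms[OF R']] by blast+
    then have h: "gen_iso R' s = v" "gen_iso R' (relabel id 1 s) = w"
      using gen_iso(1)[OF R'] by blast+
    show ?thesis
      using shift_aut_gen_iso[OF R', of s] shift_aut_gen_iso[OF R, of s] h sv by (simp add: w_def)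
  qed
  ultimately show ?thesis by blast
qed

lemma borel_reducible_conjugate:
  "borel_reducible (free_digraph_space \<F>) isomorphic_on_nat (aut_space \<Gamma>) (conjugate (aut_group \<Gamma>))"
  unfolding borel_reducible_def
proof (intro bexI ballI)
  have sp: "space (free_digraph_space \<F>) = free_digraphs"
    by (auto simp: free_digraph_space_def space_restrict_space space_PiM)
  show "isomorphic_on_nat R S \<longleftrightarrow> conjugate (aut_group \<Gamma>) (shift_aut R) (shift_aut S)"
    if "R \<in> space (free_digraph_space \<F>)" "S \<in> space (free_digraph_space \<F>)" for R S
    using that unfolding sp by (rule shift_aut_conjugate_iff)
  have "shift_aut \<in> measurable (free_digraph_space \<F>) (Pi\<^sub>M (vertices \<Gamma>) (\<lambda>_. count_space (vertices \<Gamma>)))"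
  proof (rule measurable_PiM_single')
    fix v assume v: "v \<in> vertices \<Gamma>"
    show "(\<lambda>R. shift_aut R v) \<in> measurable (free_digraph_space \<F>) (count_space (vertices \<Gamma>))"
      unfolding free_digraph_space_def
    proof (rule measurable_locally_determined)
      show "shift_aut R v \<in> vertices \<Gamma>" if "R \<in> free_digraphs" for R
        using AutD(2)[OF shift_aut_Aut[OF that] v] .
      show "\<exists>J. finite J \<and> J \<subseteq> UNIV \<and> (\<forall>y\<in>free_digraphs. (\<forall>i\<in>J. y i = R i) \<longrightarrow> shift_aut y v = shift_aut R v)"
        if "R \<in> free_digraphs" for R
        using shift_aut_local[OF that v] by simp
    qed simp
  next
    show "shift_aut \<in> space (free_digraph_space \<F>) \<rightarrow> (\<Pi>\<^sub>E v\<in>vertices \<Gamma>. space (count_space (vertices \<Gamma>)))"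
      unfolding sp using AutD(2,4)[OF shift_aut_Aut] by (auto simp: PiE_iff)
  qed
  then show "shift_aut \<in> measurable (free_digraph_space \<F>) (aut_space \<Gamma>)"
    unfolding aut_space_def
    by (rule measurable_restrict_space2[rotated]) (use shift_aut_Aut in \<open>auto simp: sp\<close>)
qed

end

subsection \<open>Coding structures into digraphs\<close>

lemma borel_reducible_trans:
  assumes "borel_reducible X E Y F" "borel_reducible Y F Z G"
  shows "borel_reducible X E Z G"
proof -
  obtain f g where f: "f \<in> measurable X Y" "\<forall>x\<in>space X. \<forall>x'\<in>space X. E x x' \<longleftrightarrow> F (f x) (f x')"
    and g: "g \<in> measurable Y Z" "\<forall>y\<in>space Y. \<forall>y'\<in>space Y. F y y' \<longleftrightarrow> G (g y) (g y')"
    using assms unfolding borel_reducible_def by blast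
  have "g \<circ> f \<in> measurable X Z" using f(1) g(1) by (rule measurable_comp)
  moreover have "\<forall>x\<in>space X. \<forall>x'\<in>space X. E x x' \<longleftrightarrow> G ((g \<circ> f) x) ((g \<circ> f) x')"
    using f(2) g(2) measurable_space[OF f(1)] by simp
  ultimately show ?thesis unfolding borel_reducible_def by blast
qed

text \<open>Any two vertices of a tournament are joined and so lie on different sides, which leaves
  room for two vertices only.\<close>

lemma free_of_bipartite:
  fixes side :: "'a \<Rightarrow> bool"
  assumes F: "\<And>T. T \<in> \<F> \<Longrightarrow> is_tournament T \<and> finite (vertices T) \<and> card (vertices T) \<ge> 3"
    and D: "\<And>x y. (x, y) \<in> edges D \<Longrightarrow> side x \<noteq> side y"
  shows "free_of \<F> D"
  unfolding free_of_iff_emb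
proof (intro ballI allI notI)
  fix T f assume T: "T \<in> \<F>" and f: "emb f T D"
  have "side (f x) \<noteq> side (f y)" if "x \<in> vertices T" "y \<in> vertices T" "x \<noteq> y" for x y
    using F[OF T] f that D[of "f x" "f y"] D[of "f y" "f x"]
    by (auto simp: is_tournament_def total_on_def emb_def)
  then have "inj_on (side \<circ> f) (vertices T)" by (auto simp: inj_on_def)
  then have "card (vertices T) \<le> card (UNIV :: bool set)" by (intro card_inj_on_le[of "side \<circ> f"]) auto
  then show False using F[OF T] by simp
qed

section \<open>Bipartite coding of structures\<close>

datatype skel = Pt nat | Tup nat "nat list" | Pos nat "nat list" nat

text \<open>All spokes and tips are present whatever the colours, some of them idle: a colouring
  affects edges only, never the vertex set.\<close>

datatype node = Main skel | Spoke skel nat | Tip skel nat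

datatype kind = PtK | TupK nat nat bool | PosK nat

instance skel :: countable by countable_datatype
instance node :: countable by countable_datatype
instance kind :: countable by countable_datatype

text \<open>Position vertices between a tuple and its entries record order and repetition, and put
  points and tuples on one side of a bipartition. Tuples of every symbol and length occur, so the
  skeleton is the same for all structures.\<close>

fun skel_edge :: "skel \<Rightarrow> skel \<Rightarrow> bool" where
  "skel_edge (Tup i xs) (Pos i' xs' j) \<longleftrightarrow> i = i' \<and> xs = xs' \<and> j < length xs"
| "skel_edge (Pos i xs j) (Pt n) \<longleftrightarrow> j < length xs \<and> xs ! j = n"
| "skel_edge _ _ \<longleftrightarrow> False"

text \<open>A skeleton vertex \<open>v\<close> is recognised by its infinitely many out-neighbours, and its colour
  \<open>c v\<close> is the number of its out-neighbours of positive finite out-degree.\<close>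

fun node_edge :: "(skel \<Rightarrow> nat) \<Rightarrow> node \<Rightarrow> node \<Rightarrow> bool" where
  "node_edge c (Main v) (Main w) \<longleftrightarrow> skel_edge v w"
| "node_edge c (Main v) (Spoke w k) \<longleftrightarrow> v = w"
| "node_edge c (Spoke v k) (Tip w l) \<longleftrightarrow> v = w \<and> k = l \<and> k < c v"
| "node_edge _ _ _ \<longleftrightarrow> False"

primrec skel_side :: "skel \<Rightarrow> bool" where
  "skel_side (Pt n) \<longleftrightarrow> False"
| "skel_side (Tup i xs) \<longleftrightarrow> False"
| "skel_side (Pos i xs j) \<longleftrightarrow> True"

primrec node_side :: "node \<Rightarrow> bool" where
  "node_side (Main v) \<longleftrightarrow> skel_side v"
| "node_side (Spoke v k) \<longleftrightarrow> \<not> skel_side v"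
| "node_side (Tip v k) \<longleftrightarrow> skel_side v"

lemma skel_edge_side: "skel_edge v w \<Longrightarrow> skel_side v \<noteq> skel_side w"
  by (cases "(v, w)" rule: skel_edge.cases) auto

lemma node_edge_side: "node_edge c x y \<Longrightarrow> node_side x \<noteq> node_side y"
  by (cases "(c, x, y)" rule: node_edge.cases) (auto dest: skel_edge_side)

lemma skel_edge_asym: "skel_edge v w \<Longrightarrow> \<not> skel_edge w v"
  by (cases "(v, w)" rule: skel_edge.cases) auto

lemma node_edge_asym: "node_edge c x y \<Longrightarrow> \<not> node_edge c y x"
  by (cases "(c, x, y)" rule: node_edge.cases) (auto dest: skel_edge_asym)

definition out_nodes :: "(skel \<Rightarrow> nat) \<Rightarrow> node \<Rightarrow> node set" where
  "out_nodes c x = {y. node_edge c x y}"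

lemma out_nodes_Spoke: "out_nodes c (Spoke v k) = (if k < c v then {Tip v k} else {})"
proof -
  have "node_edge c (Spoke v k) y \<longleftrightarrow> y = Tip v k \<and> k < c v" for y by (cases y) auto
  then show ?thesis by (auto simp: out_nodes_def)
qed

lemma out_nodes_Tip: "out_nodes c (Tip v k) = {}"
  by (simp add: out_nodes_def)

lemma infinite_out_nodes_iff: "infinite (out_nodes c x) \<longleftrightarrow> (\<exists>v. x = Main v)"
proof (cases x)
  case (Main v)
  have "inj (Spoke v)" by (rule injI) simp
  then have "infinite (range (Spoke v))" by (simp add: finite_image_iff)
  moreover have "range (Spoke v) \<subseteq> out_nodes c x" by (auto simp: out_nodes_def Main)
  ultimately show ?thesis using Main finite_subset by blast
qed (simp_all add: out_nodes_Spoke out_nodes_Tip)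

text \<open>Nonempty excludes the idle spokes, finite the out-neighbours in the skeleton; the spokes
  carrying a tip remain.\<close>

definition marked :: "(skel \<Rightarrow> nat) \<Rightarrow> node \<Rightarrow> node set" where
  "marked c x = {y \<in> out_nodes c x. finite (out_nodes c y) \<and> out_nodes c y \<noteq> {}}"

lemma card_marked: "card (marked c (Main v)) = c v"
proof -
  have "marked c (Main v) = Spoke v ` {..<c v}"
  proof (intro equalityI subsetI)
    fix y assume y: "y \<in> marked c (Main v)"
    then have "\<nexists>w. y = Main w" using infinite_out_nodes_iff[of c y] by (auto simp: marked_def)
    with y show "y \<in> Spoke v ` {..<c v}"
      by (cases y) (auto simp: marked_def out_nodes_Spoke out_nodes_def[of _ "Main v"] split: if_splits)
  qed (auto simp: marked_def out_nodes_Spoke out_nodes_def[of _ "Main v"])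
  then show ?thesis by (simp add: card_image inj_on_def)
qed

text \<open>Infinite out-degree and the number of marked out-neighbours are invariants, so an
  isomorphism respects skeleton and colours.\<close>

lemma node_iso_skel:
  assumes f: "bij f" and E: "\<And>x y. node_edge c' (f x) (f y) \<longleftrightarrow> node_edge c x y"
  obtains h where "\<And>v. f (Main v) = Main (h v)" "surj h" "\<And>v. c' (h v) = c v"
    "\<And>v w. skel_edge (h v) (h w) \<longleftrightarrow> skel_edge v w"
proof -
  have out: "out_nodes c' (f x) = f ` out_nodes c x" for x
  proof (intro equalityI subsetI)
    fix y assume "y \<in> out_nodes c' (f x)"
    moreover obtain z where "y = f z" using f by (metis bij_pointE)
    ultimately show "y \<in> f ` out_nodes c x" by (auto simp: out_nodes_def E)
  qed (auto simp: out_nodes_def E)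
  have inj: "inj_on f X" for X using f by (meson bij_is_inj inj_on_subset subset_UNIV)
  have fin: "finite (out_nodes c' (f x)) \<longleftrightarrow> finite (out_nodes c x)" for x
    unfolding out using inj by (simp add: finite_image_iff)
  have Main: "(\<exists>w. f x = Main w) \<longleftrightarrow> (\<exists>v. x = Main v)" for x
    using fin[of x] infinite_out_nodes_iff by metis
  then have "\<forall>v. \<exists>w. f (Main v) = Main w" by blast
  then obtain h where h: "\<And>v. f (Main v) = Main (h v)" by metis
  have "marked c' (f x) = f ` marked c x" for x
    unfolding marked_def out using fin by (auto simp: out)
  then have "card (marked c' (f x)) = card (marked c x)" for x using inj by (simp add: card_image)
  then have "c' (h v) = c v" for v by (metis card_marked h)
  moreover have "skel_edge (h v) (h w) \<longleftrightarrow> skel_edge v w" for v w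
    using E[of "Main v" "Main w"] by (simp add: h)
  moreover have "surj h"
    unfolding surj_def
  proof
    fix w
    obtain x where x: "f x = Main w" using f by (metis bij_pointE)
    then obtain v where "x = Main v" using Main by blast
    then show "\<exists>v. w = h v" using x h by auto
  qed
  ultimately show thesis using that h by blast
qed

text \<open>Tuples outside the language get the truth value \<open>False\<close>, so that values of
  \<open>M\<close> outside \<open>atoms I ar\<close> have no influence on the code.\<close>

definition kind_of :: "nat set \<Rightarrow> (nat \<Rightarrow> nat) \<Rightarrow> (nat \<times> nat list \<Rightarrow> bool) \<Rightarrow> skel \<Rightarrow> kind" where
  "kind_of I ar M v = (case v of Pt n \<Rightarrow> PtK
     | Tup i xs \<Rightarrow> TupK i (length xs) ((i, xs) \<in> atoms I ar \<and> M (i, xs))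
     | Pos i xs j \<Rightarrow> PosK j)"

abbreviation colour :: "nat set \<Rightarrow> (nat \<Rightarrow> nat) \<Rightarrow> (nat \<times> nat list \<Rightarrow> bool) \<Rightarrow> skel \<Rightarrow> nat" where
  "colour I ar M v \<equiv> to_nat (kind_of I ar M v)"

primrec map_skel :: "(nat \<Rightarrow> nat) \<Rightarrow> skel \<Rightarrow> skel" where
  "map_skel g (Pt n) = Pt (g n)"
| "map_skel g (Tup i xs) = Tup i (map g xs)"
| "map_skel g (Pos i xs j) = Pos i (map g xs) j"

primrec map_node :: "(skel \<Rightarrow> skel) \<Rightarrow> node \<Rightarrow> node" where
  "map_node h (Main v) = Main (h v)"
| "map_node h (Spoke v k) = Spoke (h v) k"
| "map_node h (Tip v k) = Tip (h v) k"

lemma bij_map_skel: "bij g \<Longrightarrow> bij (map_skel g)"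
proof (rule o_bij)
  assume g: "bij g"
  have "map_skel g (map_skel (inv_into UNIV g) v) = v" for v
    using g by (cases v) (auto simp: bij_is_surj surj_f_inv_f intro!: map_idI)
  moreover have "map_skel (inv_into UNIV g) (map_skel g v) = v" for v
    using g by (cases v) (auto simp: bij_is_inj intro!: map_idI)
  ultimately show "map_skel (inv_into UNIV g) \<circ> map_skel g = id" "map_skel g \<circ> map_skel (inv_into UNIV g) = id"
    by auto
qed

lemma bij_map_node: "bij h \<Longrightarrow> bij (map_node h)"
proof (rule o_bij)
  assume h: "bij h"
  have "map_node h (map_node (inv_into UNIV h) v) = v" for v
    using h by (cases v) (auto simp: bij_is_surj surj_f_inv_f)
  moreover have "map_node (inv_into UNIV h) (map_node h v) = v" for v
    using h by (cases v) (auto simp: bij_is_inj)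
  ultimately show "map_node (inv_into UNIV h) \<circ> map_node h = id" "map_node h \<circ> map_node (inv_into UNIV h) = id"
    by auto
qed

lemma skel_edge_map:
  assumes "inj g"
  shows "skel_edge (map_skel g v) (map_skel g w) \<longleftrightarrow> skel_edge v w"
  using assms by (cases "(v, w)" rule: skel_edge.cases) (auto simp: inj_eq inj_map_eq_map)

lemma node_edge_map:
  assumes "inj h" "\<And>v. c' (h v) = c v" "\<And>v w. skel_edge (h v) (h w) \<longleftrightarrow> skel_edge v w"
  shows "node_edge c' (map_node h x) (map_node h y) \<longleftrightarrow> node_edge c x y"
  using assms by (cases "(c, x, y)" rule: node_edge.cases) (auto simp: inj_eq)

text \<open>For the converse, colours single out the points, which gives the bijection
  \<open>g\<close>, and preserve symbol, length and truth value of tuples; the position vertices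
  then show that tuples are moved entrywise by \<open>g\<close>.\<close>

lemma structure_isomorphic_iff_nodes:
  "structure_isomorphic I ar M N \<longleftrightarrow>
   (\<exists>f. bij f \<and> (\<forall>x y. node_edge (colour I ar N) (f x) (f y) \<longleftrightarrow> node_edge (colour I ar M) x y))"
proof
  assume "structure_isomorphic I ar M N"
  then obtain g where g: "bij g" "\<And>i xs. (i, xs) \<in> atoms I ar \<Longrightarrow> M (i, xs) \<longleftrightarrow> N (i, map g xs)"
    unfolding structure_isomorphic_def by blast
  have "kind_of I ar N (map_skel g v) = kind_of I ar M v" for v
    using g(2) by (cases v) (auto simp: kind_of_def atoms_def)
  then have "node_edge (colour I ar N) (map_node (map_skel g) x) (map_node (map_skel g) y) \<longleftrightarrow>
      node_edge (colour I ar M) x y" for x y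
    by (intro node_edge_map) (use g(1) in \<open>simp_all add: bij_is_inj bij_map_skel skel_edge_map\<close>)
  then show "\<exists>f. bij f \<and> (\<forall>x y. node_edge (colour I ar N) (f x) (f y) \<longleftrightarrow> node_edge (colour I ar M) x y)"
    using bij_map_node[OF bij_map_skel[OF g(1)]] by blast
next
  assume "\<exists>f. bij f \<and> (\<forall>x y. node_edge (colour I ar N) (f x) (f y) \<longleftrightarrow> node_edge (colour I ar M) x y)"
  then obtain f where f: "bij f" "\<And>x y. node_edge (colour I ar N) (f x) (f y) \<longleftrightarrow> node_edge (colour I ar M) x y"
    by blast
  from node_iso_skel[OF f] obtain h where h: "\<And>v. f (Main v) = Main (h v)" "surj h"
    "\<And>v. colour I ar N (h v) = colour I ar M v" "\<And>v w. skel_edge (h v) (h w) \<longleftrightarrow> skel_edge v w"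
    by metis
  have kind: "kind_of I ar N (h v) = kind_of I ar M v" for v using h(3)[of v] by simp
  have Pt: "(\<exists>m. h v = Pt m) \<longleftrightarrow> (\<exists>n. v = Pt n)" for v
    using kind[of v] by (cases v; cases "h v") (auto simp: kind_of_def)
  then have "\<forall>n. \<exists>m. h (Pt n) = Pt m" by blast
  then obtain g where g: "\<And>n. h (Pt n) = Pt (g n)" by metis
  have "inj g"
  proof (rule injI)
    fix a b assume "g a = g b"
    then have "f (Main (Pt a)) = f (Main (Pt b))" by (simp add: h g)
    then show "a = b" using f(1) by (simp add: bij_is_inj inj_eq)
  qed
  moreover have "surj g"
    unfolding surj_def
  proof
    fix m
    obtain v where "Pt m = h v" using h(2) by (meson surjD)
    then show "\<exists>n. m = g n" using Pt[of v] g by (metis skel.inject(1))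
  qed
  moreover have "M (i, xs) \<longleftrightarrow> N (i, map g xs)" if "(i, xs) \<in> atoms I ar" for i xs
  proof -
    obtain ys where ys: "h (Tup i xs) = Tup i ys" "length ys = length xs"
      using kind[of "Tup i xs"] by (cases "h (Tup i xs)") (auto simp: kind_of_def)
    \<comment> \<open>The colour keeps the position number \<open>j\<close>; the edge from the tuple
      to its position vertex identifies the tuple, the edge from there to a point identifies the
      entry.\<close>
    have "ys ! j = g (xs ! j)" if j: "j < length xs" for j
    proof -
      obtain i' ys' where P: "h (Pos i xs j) = Pos i' ys' j"
        using kind[of "Pos i xs j"] by (cases "h (Pos i xs j)") (auto simp: kind_of_def)
      have "ys' = ys" using h(4)[of "Tup i xs" "Pos i xs j"] j by (simp add: ys P)
      then show ?thesis using h(4)[of "Pos i xs j" "Pt (xs ! j)"] j by (simp add: g P)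
    qed
    then have "ys = map g xs" using ys(2) by (auto intro: nth_equalityI)
    then show ?thesis using kind[of "Tup i xs"] that ys by (auto simp: kind_of_def atoms_def)
  qed
  ultimately show "structure_isomorphic I ar M N"
    unfolding structure_isomorphic_def bij_def by blast
qed

section \<open>Borel measurability of the coding\<close>

definition code_digraph ::
  "nat set \<Rightarrow> (nat \<Rightarrow> nat) \<Rightarrow> (nat \<times> nat list \<Rightarrow> bool) \<Rightarrow> nat \<times> nat \<Rightarrow> bool" where
  "code_digraph I ar M = (\<lambda>(m, n).
     node_edge (colour I ar M) (from_nat_into UNIV m) (from_nat_into UNIV n))"

lemma bij_from_nat_into_node: "bij (from_nat_into (UNIV :: node set))"
proof (rule bij_betw_from_nat_into)
  have "inj (\<lambda>n. Main (Pt n))" by (rule injI) simp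
  then show "infinite (UNIV :: node set)" using finite_imageD infinite_UNIV_nat finite_subset subset_UNIV by metis
qed simp

lemma structure_isomorphic_iff_code:
  "structure_isomorphic I ar M N \<longleftrightarrow> isomorphic_on_nat (code_digraph I ar M) (code_digraph I ar N)"
proof -
  define e where "e = from_nat_into (UNIV :: node set)"
  define d where "d = inv_into UNIV e"
  have e: "bij e" unfolding e_def by (rule bij_from_nat_into_node)
  have d: "bij d" and ed [simp]: "e (d x) = x" "d (e n) = n" for x n
    using e by (auto simp: d_def bij_betw_inv_into bij_is_inj bij_is_surj surj_f_inv_f)
  have "isomorphic_on_nat (code_digraph I ar M) (code_digraph I ar N) \<longleftrightarrow>
    (\<exists>k. bij k \<and> (\<forall>m n. node_edge (colour I ar N) (e (k m)) (e (k n)) \<longleftrightarrow>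
      node_edge (colour I ar M) (e m) (e n)))"
    by (auto simp: isomorphic_on_nat_def digraph_isomorphic_def digraph_iso_def digraph_on_nat_def
        code_digraph_def e_def)
  also have "\<dots> \<longleftrightarrow>
    (\<exists>f. bij f \<and> (\<forall>x y. node_edge (colour I ar N) (f x) (f y) \<longleftrightarrow> node_edge (colour I ar M) x y))"
  proof
    assume "\<exists>k. bij k \<and> (\<forall>m n. node_edge (colour I ar N) (e (k m)) (e (k n)) \<longleftrightarrow>
      node_edge (colour I ar M) (e m) (e n))"
    then obtain k where k: "bij k" "\<And>m n. node_edge (colour I ar N) (e (k m)) (e (k n)) \<longleftrightarrow>
      node_edge (colour I ar M) (e m) (e n)" by blast
    have "bij (e \<circ> (k \<circ> d))" using e d k(1) by (intro bij_comp)
    moreover have "node_edge (colour I ar N) ((e \<circ> (k \<circ> d)) x) ((e \<circ> (k \<circ> d)) y) \<longleftrightarrow>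
      node_edge (colour I ar M) x y" for x y
      using k(2)[of "d x" "d y"] by simp
    ultimately show "\<exists>f. bij f \<and> (\<forall>x y. node_edge (colour I ar N) (f x) (f y) \<longleftrightarrow> node_edge (colour I ar M) x y)"
      by blast
  next
    assume "\<exists>f. bij f \<and> (\<forall>x y. node_edge (colour I ar N) (f x) (f y) \<longleftrightarrow> node_edge (colour I ar M) x y)"
    then obtain f where f: "bij f"
      "\<And>x y. node_edge (colour I ar N) (f x) (f y) \<longleftrightarrow> node_edge (colour I ar M) x y" by blast
    have "bij (d \<circ> (f \<circ> e))" using e d f(1) by (intro bij_comp)
    moreover have "node_edge (colour I ar N) (e ((d \<circ> (f \<circ> e)) m)) (e ((d \<circ> (f \<circ> e)) n)) \<longleftrightarrow>
      node_edge (colour I ar M) (e m) (e n)" for m n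
      using f(2)[of "e m" "e n"] by simp
    ultimately show "\<exists>k. bij k \<and> (\<forall>m n. node_edge (colour I ar N) (e (k m)) (e (k n)) \<longleftrightarrow>
      node_edge (colour I ar M) (e m) (e n))" by blast
  qed
  finally show ?thesis using structure_isomorphic_iff_nodes by simp
qed

text \<open>Only edges from a spoke to a tip depend on \<open>M\<close>, through the colour of one
  skeleton vertex, and the colour of a tuple consults one atom.\<close>

lemma code_digraph_local:
  "\<exists>J. finite J \<and> J \<subseteq> atoms I ar \<and>
     (\<forall>N. (\<forall>p\<in>J. N p = M p) \<longrightarrow> code_digraph I ar N q = code_digraph I ar M q)"
proof -
  obtain m n where q: "q = (m, n)" by (cases q)
  show ?thesis
  proof (cases "\<exists>i xs k. from_nat_into UNIV m = Spoke (Tup i xs) k")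
    case True
    then obtain i xs k where m: "from_nat_into UNIV m = Spoke (Tup i xs) k" by blast
    \<comment> \<open>The intersection is empty for a tuple outside the language, whose colour does
      not consult the structure.\<close>
    have "code_digraph I ar N q = code_digraph I ar M q" if "\<forall>p\<in>{(i, xs)} \<inter> atoms I ar. N p = M p" for N
    proof -
      have "kind_of I ar N (Tup i xs) = kind_of I ar M (Tup i xs)"
        using that by (auto simp: kind_of_def)
      then show ?thesis by (cases "from_nat_into (UNIV :: node set) n") (simp_all add: code_digraph_def q m)
    qed
    then have "\<forall>N. (\<forall>p\<in>{(i, xs)} \<inter> atoms I ar. N p = M p) \<longrightarrow>
      code_digraph I ar N q = code_digraph I ar M q" by blast
    moreover have "finite ({(i, xs)} \<inter> atoms I ar)" "{(i, xs)} \<inter> atoms I ar \<subseteq> atoms I ar" by simp_all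
    ultimately show ?thesis by (intro exI conjI)
  next
    case False
    have "code_digraph I ar N q = code_digraph I ar M q" for N
    proof (cases "from_nat_into (UNIV :: node set) m")
      case (Spoke v k)
      then have "kind_of I ar N v = kind_of I ar M v" using False by (cases v) (auto simp: kind_of_def)
      then show ?thesis by (cases "from_nat_into (UNIV :: node set) n") (simp_all add: code_digraph_def q Spoke)
    qed (cases "from_nat_into (UNIV :: node set) n"; simp add: code_digraph_def q)+
    then show ?thesis using finite.emptyI empty_subsetI by blast
  qed
qed

lemma borel_reducible_structures:
  assumes F: "\<And>T. T \<in> \<F> \<Longrightarrow> is_tournament T \<and> finite (vertices T) \<and> card (vertices T) \<ge> 3"
  shows "borel_reducible (restrict_space (structure_space I ar) K) (structure_isomorphic I ar)
    (free_digraph_space \<F>) isomorphic_on_nat"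
  unfolding borel_reducible_def
proof (intro bexI ballI)
  show "structure_isomorphic I ar M N \<longleftrightarrow> isomorphic_on_nat (code_digraph I ar M) (code_digraph I ar N)"
    for M N by (rule structure_isomorphic_iff_code)
  show "code_digraph I ar \<in> measurable (restrict_space (structure_space I ar) K) (free_digraph_space \<F>)"
    unfolding free_digraph_space_def
  proof (rule measurable_restrict_space2)
    have "is_digraph (digraph_on_nat (code_digraph I ar M))" for M
    proof -
      have "\<not> node_edge c x x" for c x using node_edge_asym by blast
      then show ?thesis
        using node_edge_asym
        by (fastforce simp: is_digraph_def digraph_on_nat_def code_digraph_def irrefl_def antisym_def)
    qed
    moreover have "free_of \<F> (digraph_on_nat (code_digraph I ar M))" for M
      using F by (rule free_of_bipartite[where side = "\<lambda>n. node_side (from_nat_into UNIV n)"])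
        (auto simp: digraph_on_nat_def code_digraph_def dest: node_edge_side)
    ultimately show "code_digraph I ar \<in> space (restrict_space (structure_space I ar) K) \<rightarrow>
      {R. is_digraph (digraph_on_nat R) \<and> free_of \<F> (digraph_on_nat R)}" by simp
    show "code_digraph I ar \<in> measurable (restrict_space (structure_space I ar) K)
      (Pi\<^sub>M UNIV (\<lambda>_. count_space UNIV))"
    proof (rule measurable_PiM_single')
      fix q
      show "(\<lambda>M. code_digraph I ar M q) \<in>
        measurable (restrict_space (structure_space I ar) K) (count_space UNIV)"
        unfolding structure_space_def
      proof (rule measurable_locally_determined)
        fix M
        obtain J where "finite J" "J \<subseteq> atoms I ar"
          "\<forall>N. (\<forall>p\<in>J. N p = M p) \<longrightarrow> code_digraph I ar N q = code_digraph I ar M q"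
          using code_digraph_local[of I ar M q] by (elim exE conjE)
        then show "\<exists>J. finite J \<and> J \<subseteq> atoms I ar \<and>
            (\<forall>N\<in>K. (\<forall>p\<in>J. N p = M p) \<longrightarrow> code_digraph I ar N q = code_digraph I ar M q)"
          by (intro exI[of _ J] conjI ballI) blast+
      qed simp_all
    qed simp
  qed
qed

theorem theorem4p4:
  fixes \<F> :: "'t oriented set" and \<Gamma> :: "'v oriented"
  assumes "\<And>T. T \<in> \<F> \<Longrightarrow> is_tournament T \<and> finite (vertices T) \<and> card (vertices T) \<ge> 3"
    and "is_generic \<F> \<Gamma>"
  shows "borel_reducible (free_digraph_space \<F>) isomorphic_on_nat
           (aut_space \<Gamma>) (conjugate (aut_group \<Gamma>))
       \<and> borel_complete (aut_space \<Gamma>) (conjugate (aut_group \<Gamma>))"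
proof
  show conj: "borel_reducible (free_digraph_space \<F>) isomorphic_on_nat
      (aut_space \<Gamma>) (conjugate (aut_group \<Gamma>))"
    using assms by (rule borel_reducible_conjugate)
  show "borel_complete (aut_space \<Gamma>) (conjugate (aut_group \<Gamma>))"
    unfolding borel_complete_def
    using borel_reducible_trans[OF borel_reducible_structures[OF assms(1)] conj] by blast
qed

end
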